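(* Let $\mathcal A$ be an irreducible affine apartment of split classical type $\Phi$ and $o$ a special vertex in it. Let $\vec C$ be a Weyl chamber of $\Phi$ and $a_0$ the highest root relative to $\vec C$. Then for every vertex $x$ of $\mathcal A$ in the closure of $o+\vec C$ and every integer $r\ge 0$, $$d(x,o)\le r\iff a_0(x-o)\le r.$$
   Context: $\Phi$ is an irreducible root system of type $A_n$ ($n\ge1$), $B_n$ ($n\ge3$), $C_n$ ($n\ge2$) or $D_n$ ($n\ge4$) on the real vector space $V$ spanned by its coroots. The affine apartment of split type $\Phi$ is $\mathcal A=o+V$ decomposed into facets (a polysimplicial complex) by the walls $\{x: a(x-o)=k\}$, $a\in\Phi$, $k\in\mathbb Z$. Vertices are $0$-dimensional facets; two vertices are adjacent if they are the endpoints of an edge ($1$-dimensional facet); $d(x,y)$ is the minimal length of a sequence of consecutively adjacent vertices from $x$ to $y$ in $\mathcal A$. A vertex is special if for every $a\in\Phi$ a wall with direction $\ker a$ passes through it. The Weyl chamber $\vec C$ determines a basis $\Delta$ (the simple roots with $\vec C=\{v: a(v)>0,\ a\in\Delta\}$), and $a_0$ is the unique root whose coefficients in $\Delta$ are maximal. *)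

theory Defs
  imports "HOL-Analysis.Analysis"
begin

text \<open>
  The vector space \<open>V\<close> is a type \<open>'v::euclidean_space\<close>; only its structure of a
  finite-dimensional real vector space and its topology play a role, the inner product does not.
  Roots are linear forms, i.e. elements of the dual space \<open>'v \<Rightarrow>\<^sub>L real\<close> (every linear form on
  \<open>V\<close> is bounded). The affine space of the apartment is \<open>V\<close> with an arbitrary point \<open>q\<close>
  as the base point of the wall arrangement.
\<close>

type_synonym 'v dual = "'v \<Rightarrow>\<^sub>L real"

section \<open>Root systems in the dual of \<open>V\<close>\<close>

definition is_coroot :: "'v::euclidean_space dual set \<Rightarrow> 'v dual \<Rightarrow> 'v \<Rightarrow> bool" where
  "is_coroot \<Phi> a h \<longleftrightarrow>
     blinfun_apply a h = 2 \<and> (\<forall>b\<in>\<Phi>. b - blinfun_apply b h *\<^sub>R a \<in> \<Phi>)"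

text \<open>Reduced crystallographic root systems. The last condition is a consequence of the others.\<close>

definition root_system :: "'v::euclidean_space dual set \<Rightarrow> bool" where
  "root_system \<Phi> \<longleftrightarrow>
     finite \<Phi> \<and> 0 \<notin> \<Phi> \<and> span \<Phi> = UNIV \<and>
     (\<forall>a\<in>\<Phi>. \<exists>h. is_coroot \<Phi> a h) \<and>
     (\<forall>a\<in>\<Phi>. \<forall>h. is_coroot \<Phi> a h \<longrightarrow> (\<forall>b\<in>\<Phi>. blinfun_apply b h \<in> \<int>)) \<and>
     (\<forall>a\<in>\<Phi>. \<forall>c::real. c *\<^sub>R a \<in> \<Phi> \<longrightarrow> c = 1 \<or> c = - 1) \<and>
     span {h. \<exists>a\<in>\<Phi>. is_coroot \<Phi> a h} = UNIV"

definition irreducible_root_system :: "'v::euclidean_space dual set \<Rightarrow> bool" where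
  "irreducible_root_system \<Phi> \<longleftrightarrow>
     root_system \<Phi> \<and> \<Phi> \<noteq> {} \<and>
     \<not> (\<exists>\<Phi>1 \<Phi>2. \<Phi>1 \<noteq> {} \<and> \<Phi>2 \<noteq> {} \<and> \<Phi>1 \<union> \<Phi>2 = \<Phi> \<and> \<Phi>1 \<inter> \<Phi>2 = {} \<and>
          (\<forall>a\<in>\<Phi>1. \<forall>b\<in>\<Phi>2. \<forall>h. is_coroot \<Phi> b h \<longrightarrow> blinfun_apply a h = 0))"

text \<open>
  A root system has one of the classical types if it is isomorphic to the standard root system
  of that type. An isomorphism is given by the linear forms \<open>\<epsilon> i\<close> on \<open>V\<close> that correspond to the
  standard coordinates. For type \<open>A\<^sub>n\<close> these are the \<open>n + 1\<close> coordinates on the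
  hyperplane of \<open>\<real>\<^sup>n\<^sup>+\<^sup>1\<close> of vectors with coordinate sum \<open>0\<close>.
\<close>

definition indexed_basis :: "nat \<Rightarrow> (nat \<Rightarrow> 'v::euclidean_space dual) \<Rightarrow> bool" where
  "indexed_basis n \<epsilon> \<longleftrightarrow>
     inj_on \<epsilon> {..<n} \<and> independent (\<epsilon> ` {..<n}) \<and> span (\<epsilon> ` {..<n}) = UNIV"

definition type_A :: "nat \<Rightarrow> 'v::euclidean_space dual set \<Rightarrow> bool" where
  "type_A n \<Phi> \<longleftrightarrow> (\<exists>\<epsilon>. indexed_basis n \<epsilon> \<and> (\<Sum>i\<le>n. \<epsilon> i) = 0 \<and>
     \<Phi> = {\<epsilon> i - \<epsilon> j | i j. i \<le> n \<and> j \<le> n \<and> i \<noteq> j})"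

definition roots_D :: "nat \<Rightarrow> (nat \<Rightarrow> 'v::euclidean_space dual) \<Rightarrow> 'v dual set" where
  "roots_D n \<epsilon> = (\<Union>i<n. \<Union>j\<in>{..<n} - {i}. {\<epsilon> i + \<epsilon> j, \<epsilon> i - \<epsilon> j, - \<epsilon> i - \<epsilon> j})"

definition type_B :: "nat \<Rightarrow> 'v::euclidean_space dual set \<Rightarrow> bool" where
  "type_B n \<Phi> \<longleftrightarrow> (\<exists>\<epsilon>. indexed_basis n \<epsilon> \<and>
     \<Phi> = roots_D n \<epsilon> \<union> (\<Union>i<n. {\<epsilon> i, - \<epsilon> i}))"

definition type_C :: "nat \<Rightarrow> 'v::euclidean_space dual set \<Rightarrow> bool" where
  "type_C n \<Phi> \<longleftrightarrow> (\<exists>\<epsilon>. indexed_basis n \<epsilon> \<and>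
     \<Phi> = roots_D n \<epsilon> \<union> (\<Union>i<n. {2 *\<^sub>R \<epsilon> i, - 2 *\<^sub>R \<epsilon> i}))"

definition type_D :: "nat \<Rightarrow> 'v::euclidean_space dual set \<Rightarrow> bool" where
  "type_D n \<Phi> \<longleftrightarrow> (\<exists>\<epsilon>. indexed_basis n \<epsilon> \<and> \<Phi> = roots_D n \<epsilon>)"

definition classical_type :: "'v::euclidean_space dual set \<Rightarrow> bool" where
  "classical_type \<Phi> \<longleftrightarrow>
     (\<exists>n\<ge>1. type_A n \<Phi>) \<or> (\<exists>n\<ge>3. type_B n \<Phi>) \<or> (\<exists>n\<ge>2. type_C n \<Phi>) \<or> (\<exists>n\<ge>4. type_D n \<Phi>)"

section \<open>Weyl chambers, simple roots and the highest root\<close>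

definition weyl_chamber :: "'v::euclidean_space dual set \<Rightarrow> 'v set \<Rightarrow> bool" where
  "weyl_chamber \<Phi> C \<longleftrightarrow> C \<in> components (- (\<Union>a\<in>\<Phi>. {v. blinfun_apply a v = 0}))"

definition root_basis :: "'v::euclidean_space dual set \<Rightarrow> 'v dual set \<Rightarrow> bool" where
  "root_basis \<Phi> \<Delta> \<longleftrightarrow>
     \<Delta> \<subseteq> \<Phi> \<and> independent \<Delta> \<and> span \<Delta> = UNIV \<and>
     (\<forall>a\<in>\<Phi>. \<exists>c :: 'v dual \<Rightarrow> nat.
        a = (\<Sum>b\<in>\<Delta>. real (c b) *\<^sub>R b) \<or> a = - (\<Sum>b\<in>\<Delta>. real (c b) *\<^sub>R b))"

definition simple_roots :: "'v::euclidean_space dual set \<Rightarrow> 'v set \<Rightarrow> 'v dual set \<Rightarrow> bool" where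
  "simple_roots \<Phi> C \<Delta> \<longleftrightarrow> root_basis \<Phi> \<Delta> \<and> C = {v. \<forall>a\<in>\<Delta>. 0 < blinfun_apply a v}"

definition highest_root :: "'v::euclidean_space dual set \<Rightarrow> 'v dual set \<Rightarrow> 'v dual \<Rightarrow> bool" where
  "highest_root \<Phi> \<Delta> a0 \<longleftrightarrow>
     a0 \<in> \<Phi> \<and> (\<forall>a\<in>\<Phi>. \<forall>b\<in>\<Delta>. representation \<Delta> a b \<le> representation \<Delta> a0 b)"

section \<open>The affine apartment\<close>

definition wall :: "'v::euclidean_space \<Rightarrow> 'v dual \<Rightarrow> int \<Rightarrow> 'v set" where
  "wall q a k = {x. blinfun_apply a (x - q) = of_int k}"

text \<open>The facet of \<open>x\<close> is its class for the relation of having the same position (on the wall, or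
  strictly on the same side) with respect to every wall.\<close>

definition facet :: "'v::euclidean_space dual set \<Rightarrow> 'v \<Rightarrow> 'v \<Rightarrow> 'v set" where
  "facet \<Phi> q x = {y. \<forall>a\<in>\<Phi>. \<forall>k::int.
     sgn (blinfun_apply a (y - q) - of_int k) = sgn (blinfun_apply a (x - q) - of_int k)}"

definition facets :: "'v::euclidean_space dual set \<Rightarrow> 'v \<Rightarrow> 'v set set" where
  "facets \<Phi> q = range (facet \<Phi> q)"

definition vertex :: "'v::euclidean_space dual set \<Rightarrow> 'v \<Rightarrow> 'v \<Rightarrow> bool" where
  "vertex \<Phi> q x \<longleftrightarrow> (\<exists>F\<in>facets \<Phi> q. aff_dim F = 0 \<and> F = {x})"

definition special_vertex :: "'v::euclidean_space dual set \<Rightarrow> 'v \<Rightarrow> 'v \<Rightarrow> bool" where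
  "special_vertex \<Phi> q x \<longleftrightarrow> vertex \<Phi> q x \<and>
     (\<forall>a\<in>\<Phi>. \<exists>b\<in>\<Phi>. \<exists>k. {v. blinfun_apply b v = 0} = {v. blinfun_apply a v = 0} \<and> x \<in> wall q b k)"

definition adjacent :: "'v::euclidean_space dual set \<Rightarrow> 'v \<Rightarrow> 'v \<Rightarrow> 'v \<Rightarrow> bool" where
  "adjacent \<Phi> q x y \<longleftrightarrow> vertex \<Phi> q x \<and> vertex \<Phi> q y \<and>
     (\<exists>F\<in>facets \<Phi> q. aff_dim F = 1 \<and> F = open_segment x y)"

text \<open>The distance is extended-valued: it would be \<open>\<infinity>\<close> for vertices not joined by any path.\<close>

definition vertex_dist :: "'v::euclidean_space dual set \<Rightarrow> 'v \<Rightarrow> 'v \<Rightarrow> 'v \<Rightarrow> enat" where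
  "vertex_dist \<Phi> q x y = Inf {enat m | m. (adjacent \<Phi> q ^^ m) x y}"

end

theory Submission
  imports Defs
begin

text \<open>
  An edge lies in a strip \<open>k \<le> a \<le> k + 1\<close> for every root \<open>a\<close>, so one step of a path changes \<open>a0\<close>
  by at most \<open>1\<close>; this gives \<open>a0 (x - p) \<le> d(x, p)\<close>. Conversely, on the closed chamber \<open>a0\<close> dominates
  all roots, and it suffices to lower the bound \<open>max a (x - p) \<le> r\<close> over all roots by one along
  an edge; stated for all roots, this needs no chamber. In standard coordinates the edge is explicit.
  In type A one lowers all maximal coordinates by one (modulo constants). In the other types the
  vertices have half-integral coordinates and one moves all coordinates of one parity class by
  \<open>1/2\<close> towards zero (zeros become \<open>1/2\<close>), except in types B and D at integral points with a unique
  coordinate of maximal absolute value, where this coordinate is moved by \<open>1\<close>.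
\<close>

section \<open>Duality\<close>

text \<open>By definition an edge is a facet equal to an open segment, so exhibiting one takes two
  checks: no wall separates the ends, and the roots that are integral at \<open>x\<close> and vanish
  on \<open>y - x\<close> have only the line of \<open>y - x\<close> as common kernel. The second, a
  rank condition, restricts the possible moves. A whole parity class passes it: the moved
  coordinates are tied to each other by roots in two coordinates, and the unmoved ones are pinned
  because \<open>x\<close> is a vertex. The chamber lies in an unknown position relative to the
  coordinates \<open>\<epsilon> i\<close>. A bound on all roots does not see that position; outside
  type A it is a condition on absolute values of coordinates only. The exceptional move is forced by
  points such as (r + 1, 0, ..., 0): the half step lowers the first coordinate but raises the zeros,
  so the sums of the two are unchanged. In type C the binding roots are twice a coordinate and drop
  by one under a half step.\<close>

lemma blinfun_eq_inner:
  fixes a :: "'v::euclidean_space dual"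
  shows "blinfun_apply a v = (\<Sum>b\<in>Basis. blinfun_apply a b *\<^sub>R b) \<bullet> v"
proof -
  have "blinfun_apply a v = blinfun_apply a (\<Sum>b\<in>Basis. (v \<bullet> b) *\<^sub>R b)"
    by (simp add: euclidean_representation)
  also have "\<dots> = (\<Sum>b\<in>Basis. blinfun_apply a b *\<^sub>R b) \<bullet> v"
    by (simp add: blinfun.sum_right blinfun.scaleR_right inner_sum_left inner_commute[of v] mult.commute)
  finally show ?thesis .
qed

lemma separating_if_span_UNIV:
  fixes S :: "'v::euclidean_space dual set"
  assumes "span S = UNIV" and "\<And>a. a \<in> S \<Longrightarrow> blinfun_apply a v = 0"
  shows "v = 0"
proof -
  have "blinfun_apply a v = 0" for a :: "'v dual"
  proof -
    have "a \<in> span S" using assms(1) by simp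
    then show ?thesis
      by (induction rule: span_induct_alt) (auto simp: assms(2) blinfun.add_left blinfun.scaleR_left)
  qed
  from this[of "blinfun_inner_left v"] show "v = 0" by simp
qed

text \<open>The inner product turns forms into vectors (\<open>w\<close>). A linear form
  \<open>g\<close> with values \<open>c\<close> on the independent images exists, and
  \<open>v\<close> is the vector representing \<open>g\<close>.\<close>

lemma ex_vector_with_coordinates:
  fixes \<epsilon> :: "nat \<Rightarrow> 'v::euclidean_space dual"
  assumes "indexed_basis n \<epsilon>"
  shows "\<exists>v. \<forall>i<n. blinfun_apply (\<epsilon> i) v = c i"
proof -
  define w :: "'v dual \<Rightarrow> 'v" where "w a = (\<Sum>b\<in>Basis. blinfun_apply a b *\<^sub>R b)" for a
  have wv: "blinfun_apply a v = w a \<bullet> v" for a v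
    unfolding w_def by (rule blinfun_eq_inner)
  have lin: "linear w"
    by (rule linearI) (simp_all add: w_def blinfun.add_left blinfun.scaleR_left
        scaleR_add_left sum.distrib scaleR_sum_right)
  have inj: "inj w"
    by (rule injI) (metis wv blinfun_eqI)
  have ind: "independent (w ` \<epsilon> ` {..<n})"
    using assms lin inj linear_independent_injective_image[OF lin]
    unfolding indexed_basis_def by (meson inj_on_subset subset_UNIV)
  have inj': "inj_on (w \<circ> \<epsilon>) {..<n}"
    using assms inj unfolding indexed_basis_def
    by (meson comp_inj_on inj_on_subset subset_UNIV)
  obtain g :: "'v \<Rightarrow> real" where g: "linear g"
    "\<forall>u\<in>w ` \<epsilon> ` {..<n}. g u = c (inv_into {..<n} (w \<circ> \<epsilon>) u)"
    using linear_independent_extend[OF ind, of "\<lambda>u. c (inv_into {..<n} (w \<circ> \<epsilon>) u)"] by metis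
  define v where "v = (\<Sum>b\<in>Basis. g b *\<^sub>R b)"
  have "blinfun_apply (\<epsilon> i) v = c i" if "i < n" for i
  proof -
    have "blinfun_apply (\<epsilon> i) v = (\<Sum>b\<in>Basis. (w (\<epsilon> i) \<bullet> b) * g b)"
      by (simp add: wv v_def inner_sum_right mult.commute)
    also have "\<dots> = g (\<Sum>b\<in>Basis. (w (\<epsilon> i) \<bullet> b) *\<^sub>R b)"
      by (simp add: linear_sum[OF g(1)] linear_cmul[OF g(1)])
    also have "\<dots> = g (w (\<epsilon> i))" by (simp add: euclidean_representation)
    also have "\<dots> = c (inv_into {..<n} (w \<circ> \<epsilon>) ((w \<circ> \<epsilon>) i))" using g(2) that by auto
    also have "\<dots> = c i" using inv_into_f_f[OF inj'] that by simp
    finally show ?thesis .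
  qed
  then show ?thesis by blast
qed

lemma coordinates_eq_0:
  fixes \<epsilon> :: "nat \<Rightarrow> 'v::euclidean_space dual"
  assumes "indexed_basis n \<epsilon>" and "\<And>i. i < n \<Longrightarrow> blinfun_apply (\<epsilon> i) v = 0"
  shows "v = 0"
  using assms separating_if_span_UNIV[of "\<epsilon> ` {..<n}" v] unfolding indexed_basis_def by auto

section \<open>Vertices and edges\<close>

lemma mem_facet_self: "x \<in> facet \<Phi> p x"
  by (simp add: facet_def)

lemma facet_eq: "y \<in> facet \<Phi> p x \<Longrightarrow> facet \<Phi> p y = facet \<Phi> p x"
  by (simp add: facet_def)

lemma facetD:
  assumes "y \<in> facet \<Phi> p x" "a \<in> \<Phi>"
  shows "sgn (blinfun_apply a (y - p) - of_int k) = sgn (blinfun_apply a (x - p) - of_int k)"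
  using assms by (simp add: facet_def)

lemma vertex_iff_facet: "vertex \<Phi> p x \<longleftrightarrow> facet \<Phi> p x = {x}"
proof
  assume "vertex \<Phi> p x"
  then obtain z where "facet \<Phi> p z = {x}" unfolding vertex_def facets_def by auto
  then show "facet \<Phi> p x = {x}" using facet_eq[of x \<Phi> p z] by auto
next
  assume "facet \<Phi> p x = {x}"
  then show "vertex \<Phi> p x"
    unfolding vertex_def facets_def by (metis aff_dim_sing rangeI)
qed

text \<open>A root is integral at \<open>x\<close> exactly when one of its walls contains
  \<open>x\<close>. A small multiple of a vector killed by these roots can be added without leaving
  the facet, since the other roots stay strictly between consecutive integers. Conversely, the facet
  stays inside the walls through \<open>x\<close>.\<close>

lemma vertex_iff:
  fixes \<Phi> :: "'v::euclidean_space dual set"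
  assumes "finite \<Phi>"
  shows "vertex \<Phi> p x \<longleftrightarrow>
    (\<forall>v. (\<forall>a\<in>\<Phi>. blinfun_apply a (x - p) \<in> \<int> \<longrightarrow> blinfun_apply a v = 0) \<longrightarrow> v = 0)"
proof
  assume vert: "vertex \<Phi> p x"
  show "\<forall>v. (\<forall>a\<in>\<Phi>. blinfun_apply a (x - p) \<in> \<int> \<longrightarrow> blinfun_apply a v = 0) \<longrightarrow> v = 0"
  proof (intro allI impI)
    fix v assume v: "\<forall>a\<in>\<Phi>. blinfun_apply a (x - p) \<in> \<int> \<longrightarrow> blinfun_apply a v = 0"
    have "\<forall>\<^sub>F t in at_right (0::real). \<forall>k. sgn (blinfun_apply a (x + t *\<^sub>R v - p) - of_int k)
        = sgn (blinfun_apply a (x - p) - of_int k)" if a: "a \<in> \<Phi>" for a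
    proof (cases "blinfun_apply a (x - p) \<in> \<int>")
      case True
      then have "blinfun_apply a v = 0" using v a by blast
      then show ?thesis by (simp add: blinfun.diff_right blinfun.add_right blinfun.scaleR_right)
    next
      case False
      let ?u = "blinfun_apply a (x - p)"
      have fl: "of_int \<lfloor>?u\<rfloor> < ?u" "?u < of_int \<lfloor>?u\<rfloor> + 1"
        using False by (metis Ints_of_int floor_correct order_le_less, simp)
      have "((\<lambda>t. blinfun_apply a (x + t *\<^sub>R v - p)) \<longlongrightarrow> blinfun_apply a (x + 0 *\<^sub>R v - p)) (at_right 0)"
        by (intro tendsto_intros)
      then have lim: "((\<lambda>t. blinfun_apply a (x + t *\<^sub>R v - p)) \<longlongrightarrow> ?u) (at_right 0)" by simp
      from order_tendstoD(1)[OF lim fl(1)] order_tendstoD(2)[OF lim fl(2)]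
      show ?thesis
      proof eventually_elim
        case (elim t)
        show ?case
        proof
          fix k :: int
          show "sgn (blinfun_apply a (x + t *\<^sub>R v - p) - of_int k) = sgn (?u - of_int k)"
          proof (cases "k \<le> \<lfloor>?u\<rfloor>")
            case True
            then have "real_of_int k \<le> of_int \<lfloor>?u\<rfloor>" by simp
            then show ?thesis using elim fl by (simp add: sgn_if)
          next
            case False
            then have "real_of_int k \<ge> of_int (\<lfloor>?u\<rfloor> + 1)" by linarith
            then have "?u - of_int k < 0" "blinfun_apply a (x + t *\<^sub>R v - p) - of_int k < 0"
              using fl elim by linarith+
            then show ?thesis by (simp only: sgn_neg)
          qed
        qed
      qed
    qed
    then have "\<forall>\<^sub>F t in at_right (0::real). \<forall>a\<in>\<Phi>. \<forall>k. sgn (blinfun_apply a (x + t *\<^sub>R v - p) - of_int k)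
        = sgn (blinfun_apply a (x - p) - of_int k)"
      using assms by (simp add: eventually_ball_finite_distrib)
    then have "\<forall>\<^sub>F t in at_right (0::real). x + t *\<^sub>R v \<in> facet \<Phi> p x \<and> t > 0"
      unfolding facet_def using eventually_at_right_less[of "0::real"]
      by eventually_elim blast
    then obtain t :: real where "x + t *\<^sub>R v \<in> facet \<Phi> p x" "t > 0"
      using eventually_happens[of _ "at_right (0::real)"] by auto
    then show "v = 0" using vert by (simp add: vertex_iff_facet)
  qed
next
  assume *: "\<forall>v. (\<forall>a\<in>\<Phi>. blinfun_apply a (x - p) \<in> \<int> \<longrightarrow> blinfun_apply a v = 0) \<longrightarrow> v = 0"
  have "y = x" if y: "y \<in> facet \<Phi> p x" for y
  proof -
    have "blinfun_apply a (y - x) = 0" if a: "a \<in> \<Phi>" and int: "blinfun_apply a (x - p) \<in> \<int>" for a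
    proof -
      from int obtain k where "blinfun_apply a (x - p) = of_int k" by (auto elim: Ints_cases)
      then have "blinfun_apply a (y - p) = blinfun_apply a (x - p)"
        using facetD[OF y a, of k] by (simp add: sgn_0_0)
      then show ?thesis by (simp add: blinfun.diff_right)
    qed
    then show ?thesis using * by (metis eq_iff_diff_eq_0)
  qed
  then show "vertex \<Phi> p x" using mem_facet_self by (fastforce simp: vertex_iff_facet)
qed

text \<open>The point is that the right-hand side is free of \<open>t\<close>: a wall that does not
  separate the ends sees all interior points of the segment in the same position.\<close>

lemma sgn_convex_combination:
  fixes u w t :: real
  assumes "0 < t" "t < 1" and "(0 \<le> u \<and> 0 \<le> w) \<or> (u \<le> 0 \<and> w \<le> 0)"
  shows "sgn ((1 - t) * u + t * w) = sgn (u + w)"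
proof -
  have 1: "sgn ((1 - t) * u + t * w) = sgn (u + w)" if "0 \<le> u" "0 \<le> w" for u w
  proof (cases "u = 0 \<and> w = 0")
    case False
    then have "0 < (1 - t) * u + t * w"
      using that assms
      by (metis add_nonneg_pos add_pos_nonneg diff_gt_0_iff_gt less_eq_real_def mult_nonneg_nonneg mult_pos_pos)
    moreover have "0 < u + w" using False that by linarith
    ultimately show ?thesis by simp
  qed simp
  show ?thesis
  proof (cases "0 \<le> u \<and> 0 \<le> w")
    case True then show ?thesis using 1 by blast
  next
    case False
    then have "0 \<le> - u" "0 \<le> - w" using assms(3) by auto
    from 1[OF this] have "sgn (- ((1 - t) * u + t * w)) = sgn (- (u + w))" by (simp add: algebra_simps)
    then show ?thesis by (simp only: sgn_minus neg_equal_iff_equal)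
  qed
qed

text \<open>The facet in question is that of the midpoint. \<open>strip\<close> puts the open
  segment inside it, \<open>line\<close> keeps it on the line through \<open>x\<close> and
  \<open>y\<close>, and walls through the ends stop it there.\<close>

lemma adjacentI:
  fixes \<Phi> :: "'v::euclidean_space dual set"
  assumes "finite \<Phi>" and vx: "vertex \<Phi> p x" and vy: "vertex \<Phi> p y" and "x \<noteq> y"
    and strip: "\<And>a. a \<in> \<Phi> \<Longrightarrow> \<exists>k::int. of_int k \<le> blinfun_apply a (x - p) \<and> blinfun_apply a (x - p) \<le> of_int k + 1
        \<and> of_int k \<le> blinfun_apply a (y - p) \<and> blinfun_apply a (y - p) \<le> of_int k + 1"
    and line: "\<And>v. (\<And>a. a \<in> \<Phi> \<Longrightarrow> blinfun_apply a (x - p) \<in> \<int> \<Longrightarrow> blinfun_apply a (y - x) = 0 \<Longrightarrow>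
        blinfun_apply a v = 0) \<Longrightarrow> \<exists>c. v = c *\<^sub>R (y - x)"
  shows "adjacent \<Phi> p x y"
proof -
  define m where "m = (1/2) *\<^sub>R (x + y)"
  have m: "blinfun_apply a (m - p) = (blinfun_apply a (x - p) + blinfun_apply a (y - p)) / 2" for a :: "'v dual"
    by (simp add: m_def blinfun.diff_right blinfun.add_right blinfun.scaleR_right field_simps)
  have "facet \<Phi> p m = open_segment x y"
  proof (intro set_eqI iffI)
    fix z assume z: "z \<in> open_segment x y"
    then obtain t where t: "0 < t" "t < 1" "z = (1 - t) *\<^sub>R x + t *\<^sub>R y"
      by (auto simp: in_segment)
    show "z \<in> facet \<Phi> p m"
      unfolding facet_def
    proof (intro CollectI ballI allI)
      fix a and k :: int assume "a \<in> \<Phi>"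
      from strip[OF this] obtain j :: int where j:
        "of_int j \<le> blinfun_apply a (x - p) \<and> blinfun_apply a (x - p) \<le> of_int j + 1"
        "of_int j \<le> blinfun_apply a (y - p) \<and> blinfun_apply a (y - p) \<le> of_int j + 1"
        by blast
      define u w where "u = blinfun_apply a (x - p) - of_int k" "w = blinfun_apply a (y - p) - of_int k"
      have "(0 \<le> u \<and> 0 \<le> w) \<or> (u \<le> 0 \<and> w \<le> 0)"
      proof (cases "k \<le> j")
        case True
        then have "real_of_int k \<le> of_int j" by simp
        then show ?thesis using j u_w_def by auto
      next
        case False
        then have "real_of_int k \<ge> of_int j + 1" by linarith
        then show ?thesis using j u_w_def by auto
      qed
      note s = sgn_convex_combination[OF _ _ this]
      have "blinfun_apply a (z - p) - of_int k = (1 - t) * u + t * w"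
        by (simp add: t u_w_def blinfun.diff_right blinfun.add_right blinfun.scaleR_right algebra_simps)
      moreover have "blinfun_apply a (m - p) - of_int k = (1 - 1/2) * u + (1/2) * w"
        by (simp add: m u_w_def field_simps)
      ultimately show "sgn (blinfun_apply a (z - p) - of_int k) = sgn (blinfun_apply a (m - p) - of_int k)"
        using s[OF t(1,2)] s[of "1/2"] by simp
    qed
  next
    fix z assume z: "z \<in> facet \<Phi> p m"
    have "blinfun_apply a (z - x) = 0"
      if a: "a \<in> \<Phi>" "blinfun_apply a (x - p) \<in> \<int>" "blinfun_apply a (y - x) = 0" for a
    proof -
      from a(2) obtain k where k: "blinfun_apply a (x - p) = of_int k" by (auto elim: Ints_cases)
      have "blinfun_apply a (m - p) = of_int k"
        using k a(3) m[of a] by (simp add: blinfun.diff_right[of a y x] blinfun.diff_right[of a _ p])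
      then have "blinfun_apply a (z - p) = of_int k"
        using facetD[OF z a(1), of k] by (simp add: sgn_0_0)
      then show ?thesis using k by (simp add: blinfun.diff_right)
    qed
    from line[OF this] obtain c where c: "z - x = c *\<^sub>R (y - x)" by blast
    have "y - x \<noteq> 0" using assms by simp
    \<comment> \<open>Each end, being a vertex, lies on a wall transverse to the segment: the one
      through \<open>x\<close> forces \<open>0 < c\<close>, the one through \<open>y\<close> forces
      \<open>c < 1\<close>.\<close>
    with vx obtain a where a: "a \<in> \<Phi>" "blinfun_apply a (x - p) \<in> \<int>" "blinfun_apply a (y - x) \<noteq> 0"
      unfolding vertex_iff[OF assms(1)] by blast
    from vy \<open>y - x \<noteq> 0\<close> obtain b where b: "b \<in> \<Phi>" "blinfun_apply b (y - p) \<in> \<int>" "blinfun_apply b (y - x) \<noteq> 0"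
      unfolding vertex_iff[OF assms(1)] by blast
    have z_eq: "z = x + c *\<^sub>R (y - x)" using c by (simp add: algebra_simps)
    have zx: "blinfun_apply d (z - p) = blinfun_apply d (x - p) + c * blinfun_apply d (y - x)"
      and zy: "blinfun_apply d (z - p) = blinfun_apply d (y - p) + (c - 1) * blinfun_apply d (y - x)"
      for d :: "'v dual"
      by (simp_all add: z_eq blinfun.diff_right blinfun.add_right blinfun.scaleR_right algebra_simps)
    have mx: "blinfun_apply d (m - p) = blinfun_apply d (x - p) + blinfun_apply d (y - x) / 2"
      and my: "blinfun_apply d (m - p) = blinfun_apply d (y - p) - blinfun_apply d (y - x) / 2"
      for d :: "'v dual"
    proof -
      have "blinfun_apply d (y - x) = blinfun_apply d (y - p) - blinfun_apply d (x - p)"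
        by (simp add: blinfun.diff_right)
      then show "blinfun_apply d (m - p) = blinfun_apply d (x - p) + blinfun_apply d (y - x) / 2"
        and "blinfun_apply d (m - p) = blinfun_apply d (y - p) - blinfun_apply d (y - x) / 2"
        by (simp_all add: m field_simps)
    qed
    from a(2) obtain k where "blinfun_apply a (x - p) = of_int k" by (auto elim: Ints_cases)
    then have "sgn (c * blinfun_apply a (y - x)) = sgn (blinfun_apply a (y - x) / 2)"
      using facetD[OF z a(1), of k] by (simp add: zx mx)
    then have "sgn c = 1" using a(3) by (simp add: sgn_mult sgn_0_0)
    then have "0 < c" by (simp add: sgn_1_pos)
    from b(2) obtain l where "blinfun_apply b (y - p) = of_int l" by (auto elim: Ints_cases)
    then have "sgn ((c - 1) * blinfun_apply b (y - x)) = sgn (- (blinfun_apply b (y - x) / 2))"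
      using facetD[OF z b(1), of l] by (simp add: zy my)
    then have "(sgn (c - 1) + 1) * sgn (blinfun_apply b (y - x)) = 0"
      unfolding sgn_mult by (simp add: ring_distribs sgn_minus)
    then have "sgn (c - 1) = - 1" using b(3) by (simp add: sgn_0_0)
    then have "c < 1" by (simp add: sgn_1_neg)
    have "z = (1 - c) *\<^sub>R x + c *\<^sub>R y" using c by (simp add: algebra_simps)
    then show "z \<in> open_segment x y"
      using \<open>0 < c\<close> \<open>c < 1\<close> \<open>x \<noteq> y\<close> by (auto simp: in_segment)
  qed
  moreover have "aff_dim (open_segment x y) = 1"
    using \<open>x \<noteq> y\<close>
    by (metis affine_hull_open_segment aff_dim_2 aff_dim_affine_hull)
  ultimately show ?thesis
    unfolding adjacent_def facets_def using vx vy by (metis rangeI)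
qed

text \<open>Otherwise a wall strictly separates the ends. The crossing point lies on it, and all
  interior points have the same sign as that point, so an affine function with different values at
  the ends would vanish along the segment.\<close>

lemma adjacent_diff_le_1:
  assumes "adjacent \<Phi> p x y" "a \<in> \<Phi>"
  shows "blinfun_apply a (x - y) \<le> 1"
proof (rule ccontr)
  assume "\<not> ?thesis"
  then have gt: "blinfun_apply a (x - p) > blinfun_apply a (y - p) + 1" by (simp add: blinfun.diff_right)
  \<comment> \<open>The least integer above the value at \<open>y\<close>; a gap larger than one
    puts it below the value at \<open>x\<close>.\<close>
  define k where "k = \<lfloor>blinfun_apply a (y - p)\<rfloor> + 1"
  define u w where "u = blinfun_apply a (x - p) - of_int k" "w = blinfun_apply a (y - p) - of_int k"
  have uw: "u > 0" "w < 0" using gt unfolding u_w_def k_def by linarith+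
  obtain z where z: "facet \<Phi> p z = open_segment x y"
    using assms(1) unfolding adjacent_def facets_def by auto
  have "x \<noteq> y" using uw u_w_def by auto
  define pt where "pt t = (1 - t) *\<^sub>R x + t *\<^sub>R y" for t
  have pt: "sgn ((1 - t) * u + t * w) = sgn (blinfun_apply a (z - p) - of_int k)" if "0 < t" "t < 1" for t
  proof -
    have "pt t \<in> facet \<Phi> p z" using that \<open>x \<noteq> y\<close> by (auto simp: z in_segment pt_def)
    moreover have "blinfun_apply a (pt t - p) - of_int k = (1 - t) * u + t * w"
      by (simp add: pt_def u_w_def blinfun.diff_right blinfun.add_right blinfun.scaleR_right algebra_simps)
    ultimately show ?thesis using facetD[of "pt t" \<Phi> p z a k] assms(2) by simp
  qed
  \<comment> \<open>The parameter of the crossing point; \<open>t/2\<close> below is merely a second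
    interior parameter.\<close>
  define t where "t = u / (u - w)"
  have t: "0 < t" "t < 1" using uw by (auto simp: t_def field_simps)
  have "(1 - t) * u + t * w = 0" using uw by (simp add: t_def field_simps)
  then have "(1 - t/2) * u + (t/2) * w = 0"
    using pt[OF t] pt[of "t/2"] t by (simp add: sgn_0_0)
  with \<open>(1 - t) * u + t * w = 0\<close> have "t * (u - w) = 0" by argo
  then show False using t uw by simp
qed

section \<open>Distance\<close>

text \<open>A nonempty set of extended naturals attains its infimum, and the empty set has infimum
  infinity, which no finite bound admits.\<close>

lemma vertex_dist_le_iff:
  "vertex_dist \<Phi> q x y \<le> enat r \<longleftrightarrow> (\<exists>m\<le>r. (adjacent \<Phi> q ^^ m) x y)"
proof
  assume le: "vertex_dist \<Phi> q x y \<le> enat r"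
  let ?S = "{enat m | m. (adjacent \<Phi> q ^^ m) x y}"
  have "?S \<noteq> {}"
  proof
    assume "?S = {}"
    then show False using le unfolding vertex_dist_def by (simp add: top_enat_def)
  qed
  then have "Inf ?S \<in> ?S" unfolding Inf_enat_def by (auto intro: LeastI)
  then show "\<exists>m\<le>r. (adjacent \<Phi> q ^^ m) x y" using le unfolding vertex_dist_def by force
next
  assume "\<exists>m\<le>r. (adjacent \<Phi> q ^^ m) x y"
  then obtain m where "m \<le> r" "(adjacent \<Phi> q ^^ m) x y" by blast
  then have "Inf {enat m | m. (adjacent \<Phi> q ^^ m) x y} \<le> enat m" by (intro Inf_lower) blast
  then show "vertex_dist \<Phi> q x y \<le> enat r"
    unfolding vertex_dist_def using \<open>m \<le> r\<close> by (meson enat_ord_simps(1) order_trans)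
qed

lemma relpow_adjacent_diff_le:
  assumes "(adjacent \<Phi> p ^^ m) x y" "a \<in> \<Phi>"
  shows "blinfun_apply a (x - y) \<le> real m"
  using assms(1)
proof (induction m arbitrary: y)
  case (Suc m)
  then obtain z where z: "(adjacent \<Phi> p ^^ m) x z" "adjacent \<Phi> p z y" by auto
  from Suc.IH[OF z(1)] adjacent_diff_le_1[OF z(2) assms(2)] show ?case
    by (simp add: blinfun.diff_right)
qed (simp add: blinfun.zero_right)

text \<open>The alternative \<open>y = x\<close> covers vertices that already satisfy the bound
  \<open>r\<close>, such as \<open>x = p\<close>; the resulting paths therefore have length at most
  \<open>r\<close>, not exactly \<open>r\<close>.\<close>

definition descending :: "'v::euclidean_space dual set \<Rightarrow> 'v \<Rightarrow> bool" where
  "descending \<Phi> p \<longleftrightarrow> (\<forall>x r. vertex \<Phi> p x \<longrightarrow> (\<forall>a\<in>\<Phi>. blinfun_apply a (x - p) \<le> real (Suc r)) \<longrightarrow>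
     (\<exists>y. (y = x \<or> adjacent \<Phi> p x y) \<and> (\<forall>a\<in>\<Phi>. blinfun_apply a (y - p) \<le> real r)))"

lemma relpow_adjacent_if_descending:
  fixes \<Phi> :: "'v::euclidean_space dual set"
  assumes "descending \<Phi> p" and "span \<Phi> = UNIV" and "\<And>a. a \<in> \<Phi> \<Longrightarrow> - a \<in> \<Phi>"
    and "vertex \<Phi> p x" "\<forall>a\<in>\<Phi>. blinfun_apply a (x - p) \<le> real r"
  shows "\<exists>m\<le>r. (adjacent \<Phi> p ^^ m) x p"
  using assms(4,5)
proof (induction r arbitrary: x)
  case 0
  have "blinfun_apply a (x - p) = 0" if "a \<in> \<Phi>" for a
    using bspec[OF 0(2) that] bspec[OF 0(2) assms(3)[OF that]] by (simp add: blinfun.minus_left)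
  then have "x - p = 0" using separating_if_span_UNIV[OF assms(2)] by blast
  then show ?case by simp
next
  case (Suc r)
  then obtain y where y: "y = x \<or> adjacent \<Phi> p x y" "\<forall>a\<in>\<Phi>. blinfun_apply a (y - p) \<le> real r"
    using assms(1) unfolding descending_def by blast
  then have "vertex \<Phi> p y" using Suc.prems unfolding adjacent_def by blast
  from Suc.IH[OF this y(2)] obtain m where m: "m \<le> r" "(adjacent \<Phi> p ^^ m) y p" by blast
  show ?case
  proof (cases "y = x")
    case True
    then show ?thesis using m by (meson le_SucI)
  next
    case False
    then have "(adjacent \<Phi> p ^^ Suc m) x p" using y m by (intro relpowp_Suc_I2) auto
    then show ?thesis using m by (meson Suc_le_mono)
  qed
qed


section \<open>Type A\<close>

lemma descending_type_A:
  fixes \<Phi> :: "'v::euclidean_space dual set"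
  assumes "finite \<Phi>" "type_A n \<Phi>"
  shows "descending \<Phi> p"
proof -
  obtain \<epsilon> :: "nat \<Rightarrow> 'v dual" where basis: "indexed_basis n \<epsilon>" and sum0: "(\<Sum>i\<le>n. \<epsilon> i) = 0"
    and \<Phi>: "\<Phi> = {\<epsilon> i - \<epsilon> j | i j. i \<le> n \<and> j \<le> n \<and> i \<noteq> j}"
    using assms(2) unfolding type_A_def by blast
  have sum0': "(\<Sum>i\<le>n. blinfun_apply (\<epsilon> i) v) = 0" for v
    using arg_cong[OF sum0, of "\<lambda>a. blinfun_apply a v"] by (simp add: blinfun.sum_left)
  have ex: "\<exists>v. \<forall>i\<le>n. blinfun_apply (\<epsilon> i) v = c i" if "(\<Sum>i\<le>n. c i) = 0" for c
  proof -
    obtain v where v: "\<forall>i<n. blinfun_apply (\<epsilon> i) v = c i"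
      using ex_vector_with_coordinates[OF basis] by blast
    then have "(\<Sum>i<n. blinfun_apply (\<epsilon> i) v) = (\<Sum>i<n. c i)" by simp
    then have "blinfun_apply (\<epsilon> n) v = c n"
      using sum0'[of v] that unfolding lessThan_Suc_atMost[symmetric] by simp
    then show ?thesis using v by (metis le_neq_implies_less)
  qed
  have const: "v = 0" if v: "\<And>i j. i \<le> n \<Longrightarrow> j \<le> n \<Longrightarrow> blinfun_apply (\<epsilon> i) v = blinfun_apply (\<epsilon> j) v" for v
  proof (rule coordinates_eq_0[OF basis])
    fix i assume "i < n"
    then have "(\<Sum>j\<le>n. blinfun_apply (\<epsilon> j) v) = (\<Sum>j\<le>n. blinfun_apply (\<epsilon> i) v)"
      using \<open>i < n\<close> by (intro sum.cong refl v) auto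
    then show "blinfun_apply (\<epsilon> i) v = 0" using sum0'[of v] by simp
  qed
  \<comment> \<open>An indicator function becomes a vector of \<open>V\<close> after subtracting its
    mean \<open>t\<close>, which cancels in every root.\<close>
  have ind: "\<exists>v. \<forall>i\<le>n. blinfun_apply (\<epsilon> i) v = of_bool (P i) - t"
    if "t = real (card {i. i \<le> n \<and> P i}) / (n + 1)" for P t
  proof (rule ex)
    have "(\<Sum>i\<le>n. of_bool (P i)) = real (card {i. i \<le> n \<and> P i})"
      by simp (metis Collect_conj_eq atMost_def)
    then show "(\<Sum>i\<le>n. of_bool (P i) - t) = 0" by (simp add: sum_subtractf that del: sum_of_bool_eq)
  qed
  show ?thesis
    unfolding descending_def
  proof (intro allI impI)
    fix x and r :: nat
    assume vx: "vertex \<Phi> p x" and le: "\<forall>a\<in>\<Phi>. blinfun_apply a (x - p) \<le> real (Suc r)"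
    define X where "X i = blinfun_apply (\<epsilon> i) (x - p)" for i
    have int: "X i - X j \<in> \<int>" if ij: "i \<le> n" "j \<le> n" for i j
    proof (rule ccontr)
      assume no: "X i - X j \<notin> \<int>"
      \<comment> \<open>The class of \<open>j\<close> modulo the integers. An integral root involves
        two indices of the same class or two outside it, so it kills the indicator of the
        class.\<close>
      define P where "P l \<longleftrightarrow> X l - X j \<in> \<int>" for l
      obtain v t where v: "\<forall>i\<le>n. blinfun_apply (\<epsilon> i) v = of_bool (P i) - t" using ind by blast
      have "blinfun_apply a v = 0" if "a \<in> \<Phi>" "blinfun_apply a (x - p) \<in> \<int>" for a
      proof -
        obtain k l where kl: "a = \<epsilon> k - \<epsilon> l" "k \<le> n" "l \<le> n" using \<open>a \<in> \<Phi>\<close> \<Phi> by blast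
        then have "X k - X l \<in> \<int>" using that(2) by (simp add: X_def blinfun.diff_left)
        then have "P k = P l" unfolding P_def
          using Ints_add[of "X k - X l" "X l - X j"] Ints_diff[of "X k - X j" "X k - X l"] by auto
        then show ?thesis using kl v by (simp add: blinfun.diff_left)
      qed
      then have "v = 0" using vx unfolding vertex_iff[OF assms(1)] by blast
      then have "of_bool (P i) = (of_bool (P j) :: real)" using v ij by (simp add: blinfun.zero_right)
      then show False using no by (simp add: P_def)
    qed
    have bound: "X i - X j \<le> real (Suc r)" if "i \<le> n" "j \<le> n" for i j
    proof (cases "i = j")
      case False
      then have "\<epsilon> i - \<epsilon> j \<in> \<Phi>" using that \<Phi> by blast
      then show ?thesis using le unfolding X_def by (metis blinfun.diff_left)
    qed simp
    have "Max (X ` {..n}) \<in> X ` {..n}" by (intro Max_in) auto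
    then obtain m where "Max (X ` {..n}) = X m" "m \<in> {..n}" by (rule imageE)
    then have m: "m \<le> n" "\<And>i. i \<le> n \<Longrightarrow> X i \<le> X m"
      using Max_ge[of "X ` {..n}"] by auto
    define P where "P i \<longleftrightarrow> X i = X m" for i
    obtain w t where w: "\<forall>i\<le>n. blinfun_apply (\<epsilon> i) w = of_bool (P i) - t" using ind by blast
    show "\<exists>y. (y = x \<or> adjacent \<Phi> p x y) \<and> (\<forall>a\<in>\<Phi>. blinfun_apply a (y - p) \<le> real r)"
    proof (cases "\<forall>i\<le>n. P i")
      case True
      then have "blinfun_apply a (x - p) \<le> real r" if "a \<in> \<Phi>" for a
        using that \<Phi> by (auto simp: P_def X_def blinfun.diff_left)
      then show ?thesis by blast
    next
      case False
      then obtain l where l: "l \<le> n" "\<not> P l" by blast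
      define y where "y = x - w"
      have Y: "blinfun_apply (\<epsilon> i) (y - p) = X i - of_bool (P i) + t" if "i \<le> n" for i
        using that w by (simp add: y_def X_def blinfun.diff_right)
      have "w \<noteq> 0"
      proof
        assume "w = 0"
        have "P m" by (simp add: P_def)
        then have "blinfun_apply (\<epsilon> m) w = 1 - t" "blinfun_apply (\<epsilon> l) w = - t"
          using w l m(1) by simp_all
        then show False using \<open>w = 0\<close> by (simp add: blinfun.zero_right)
      qed
      have "adjacent \<Phi> p x y"
      proof (rule adjacentI[OF assms(1) vx])
        show "x \<noteq> y" using \<open>w \<noteq> 0\<close> by (simp add: y_def)
        show "vertex \<Phi> p y"
          unfolding vertex_iff[OF assms(1)]
        proof (intro allI impI, rule const)
          fix v i j
          assume *: "\<forall>a\<in>\<Phi>. blinfun_apply a (y - p) \<in> \<int> \<longrightarrow> blinfun_apply a v = 0" "i \<le> n" "j \<le> n"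
          show "blinfun_apply (\<epsilon> i) v = blinfun_apply (\<epsilon> j) v"
          proof (cases "i = j")
            case False
            then have "\<epsilon> i - \<epsilon> j \<in> \<Phi>" using * \<Phi> by blast
            moreover have "blinfun_apply (\<epsilon> i - \<epsilon> j) (y - p) = (X i - X j) - (of_bool (P i) - of_bool (P j))"
              using * by (simp add: blinfun.diff_left Y)
            moreover have "\<dots> \<in> \<int>" by (rule Ints_diff[OF int]) (use * in auto)
            ultimately have "blinfun_apply (\<epsilon> i - \<epsilon> j) v = 0" using *(1) by metis
            then show ?thesis by (simp add: blinfun.diff_left)
          qed simp
        qed
        fix a assume "a \<in> \<Phi>"
        then obtain i j where ij: "a = \<epsilon> i - \<epsilon> j" "i \<le> n" "j \<le> n" using \<Phi> by blast
        obtain d where d: "X i - X j = of_int d" using int ij by (meson Ints_cases)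
        have ax: "blinfun_apply a (x - p) = of_int d"
          and ay: "blinfun_apply a (y - p) = of_int d - (of_bool (P i) - of_bool (P j))"
          using ij d by (simp_all add: blinfun.diff_left X_def[symmetric] Y)
        \<comment> \<open>The value \<open>d\<close> drops by one only if \<open>i\<close> is moved
          and \<open>j\<close> is not; otherwise it stays or rises by one.\<close>
        show "\<exists>k::int. of_int k \<le> blinfun_apply a (x - p) \<and> blinfun_apply a (x - p) \<le> of_int k + 1
            \<and> of_int k \<le> blinfun_apply a (y - p) \<and> blinfun_apply a (y - p) \<le> of_int k + 1"
          unfolding ax ay
          by (rule exI[of _ "if P i \<and> \<not> P j then d - 1 else d"]) auto
      next
        fix v assume v: "\<And>a. a \<in> \<Phi> \<Longrightarrow> blinfun_apply a (x - p) \<in> \<int> \<Longrightarrow>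
            blinfun_apply a (y - x) = 0 \<Longrightarrow> blinfun_apply a v = 0"
        have eq: "blinfun_apply (\<epsilon> i) v = blinfun_apply (\<epsilon> j) v" if "i \<le> n" "j \<le> n" "P i = P j" for i j
        proof (cases "i = j")
          case False
          have "blinfun_apply (\<epsilon> i - \<epsilon> j) v = 0"
          proof (rule v)
            show "\<epsilon> i - \<epsilon> j \<in> \<Phi>" using that False \<Phi> by blast
            show "blinfun_apply (\<epsilon> i - \<epsilon> j) (x - p) \<in> \<int>" using int that by (simp add: blinfun.diff_left X_def)
            show "blinfun_apply (\<epsilon> i - \<epsilon> j) (y - x) = 0"
              using w that by (simp add: y_def blinfun.diff_left blinfun.minus_right)
          qed
          then show ?thesis by (simp add: blinfun.diff_left)
        qed simp
        \<comment> \<open>\<open>v\<close> has one value on the moved coordinates and one on the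
          others. Subtracting their difference times \<open>w\<close> makes all coordinates equal,
          hence zero.\<close>
        define s where "s = blinfun_apply (\<epsilon> m) v - blinfun_apply (\<epsilon> l) v"
        have coord: "blinfun_apply (\<epsilon> i) (v - s *\<^sub>R w) = blinfun_apply (\<epsilon> l) v + s * t" if "i \<le> n" for i
        proof -
          have expand: "blinfun_apply (\<epsilon> i) (v - s *\<^sub>R w) = blinfun_apply (\<epsilon> i) v - s * (of_bool (P i) - t)"
            using w that by (simp add: blinfun.diff_right blinfun.scaleR_right)
          show ?thesis
          proof (cases "P i")
            case True
            then have "blinfun_apply (\<epsilon> i) v = blinfun_apply (\<epsilon> m) v"
              by (intro eq[OF that m(1)]) (simp add: P_def)
            then show ?thesis
              using True unfolding expand by (simp add: s_def algebra_simps)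
          next
            case False
            then have "blinfun_apply (\<epsilon> i) v = blinfun_apply (\<epsilon> l) v"
              by (intro eq[OF that l(1)]) (simp add: l(2))
            then show ?thesis using False unfolding expand by simp
          qed
        qed
        have "v - s *\<^sub>R w = 0" by (rule const) (simp add: coord)
        then have "v = (- s) *\<^sub>R (y - x)" by (simp add: y_def)
        then show "\<exists>c. v = c *\<^sub>R (y - x)" by blast
      qed
      moreover have "blinfun_apply a (y - p) \<le> real r" if "a \<in> \<Phi>" for a
      proof -
        obtain i j where ij: "a = \<epsilon> i - \<epsilon> j" "i \<le> n" "j \<le> n" using \<Phi> \<open>a \<in> \<Phi>\<close> by blast
        have ay: "blinfun_apply a (y - p) = X i - X j - (of_bool (P i) - of_bool (P j))"
          using ij by (simp add: blinfun.diff_left Y)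
        obtain d where d: "X m - X i = of_int d" using int ij m by (meson Ints_cases)
        \<comment> \<open>Integrality of the differences gives the whole unit needed when neither
          \<open>i\<close> nor \<open>j\<close> is moved.\<close>
        have "X i \<le> X m - 1" if "\<not> P i"
        proof -
          have "X m - X i > 0" using m(2)[OF ij(2)] that by (simp add: P_def)
          then have "d \<ge> 1" using d by simp
          then show ?thesis using d by linarith
        qed
        then show ?thesis
          unfolding ay using bound[OF ij(2,3)] bound[OF m(1) ij(3)] m(2)[OF ij(2)]
          by (cases "P i"; cases "P j") (auto simp: P_def)
      qed
      ultimately show ?thesis by blast
    qed
  qed
qed


section \<open>Types B, C and D\<close>

text \<open>\<open>A\<close> and \<open>B\<close> are twice the values of a root at the two ends. A
  jump by two fills a whole unit interval, so it has to start on a wall, that is, at an even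
  \<open>A\<close>.\<close>

lemma strip_half_integers:
  fixes A B :: int
  assumes "\<bar>A - B\<bar> \<le> 1 \<or> (\<bar>A - B\<bar> \<le> 2 \<and> even A)"
  shows "\<exists>k::int. of_int k \<le> (of_int A / 2 :: real) \<and> (of_int A / 2 :: real) \<le> of_int k + 1
     \<and> of_int k \<le> (of_int B / 2 :: real) \<and> (of_int B / 2 :: real) \<le> of_int k + 1"
proof -
  define k where "k = min A B div 2"
  have "2 * k \<le> A" "A \<le> 2 * k + 2" "2 * k \<le> B" "B \<le> 2 * k + 2"
    using assms unfolding k_def by (auto simp: min_def; presburger)+
  then have "real_of_int (2 * k) \<le> of_int A" "real_of_int A \<le> of_int (2 * k + 2)"
    "real_of_int (2 * k) \<le> of_int B" "real_of_int B \<le> of_int (2 * k + 2)"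
    by (simp_all only: of_int_le_iff)
  then show ?thesis by (intro exI[of _ k]) auto
qed

lemma half_in_Ints_iff: "(of_int A / 2 :: real) \<in> \<int> \<longleftrightarrow> even A"
proof
  assume "(of_int A / 2 :: real) \<in> \<int>"
  then obtain k where "(of_int A / 2 :: real) = of_int k" by (meson Ints_cases)
  then have "real_of_int A = of_int (2 * k)" by simp
  then have "A = 2 * k" by (simp only: of_int_eq_iff)
  then show "even A" by simp
qed auto

text \<open>Here and in the next two lemmas \<open>a\<close> and \<open>b\<close> are absolute
  values of doubled coordinates, \<open>M\<close> is the largest one, and \<open>R\<close> is the
  old bound. For different parities \<open>a + b\<close> is odd, which saves one unit. If both are
  even, then \<open>a \<noteq> M\<close>, so the odd sum \<open>M + a\<close> is at most
  \<open>2 * R - 1\<close>, and \<open>b \<le> M - 1\<close>.\<close>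

lemma shrink_odd:
  fixes a b M R :: int
  assumes "a \<le> M" "b \<le> M" "a + b \<le> 2 * R" "odd M" "a = M \<or> M + a \<le> 2 * R"
  shows "(if even a then a else a - 1) + (if even b then b else b - 1) \<le> 2 * R - 2"
  using assms by (cases "even a"; cases "even b"; simp; presburger)

text \<open>The odd entry \<open>h\<close> forces \<open>M \<le> 2 * R - 2\<close>, which leaves the
  room needed by the zeros that are raised to one.\<close>

lemma shrink_even_mixed:
  fixes a b h M R :: int
  assumes "a \<le> M" "b \<le> M" "h \<le> M" "0 \<le> h" "a + b \<le> 2 * R" "even M" "odd h" "M + h \<le> 2 * R"
    "b = M \<or> M + b \<le> 2 * R"
  shows "(if even a then if a = 0 then 1 else a - 1 else a) +
    (if even b then if b = 0 then 1 else b - 1 else b) \<le> 2 * R - 2"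
proof -
  have "1 \<le> h" using assms by presburger
  then have "2 \<le> M" using assms by presburger
  have "M + 1 \<le> 2 * R" using \<open>1 \<le> h\<close> assms by linarith
  then have "M + 2 \<le> 2 * R" using \<open>even M\<close> by presburger
  then show ?thesis
    using assms(1,2,5,6,9) \<open>2 \<le> M\<close>
    by (cases "even a"; cases "even b"; cases "a = 0"; cases "b = 0"; simp; presburger)
qed

text \<open>A second entry equal to \<open>M\<close> gives \<open>M \<le> R\<close>. As
  \<open>M \<ge> 2\<close>, every entry ends at most at \<open>M - 1\<close>, including the raised
  zeros.\<close>

lemma shrink_even_tie:
  fixes a b M R :: int
  assumes "a \<le> M" "b \<le> M" "even a" "even b" "even M" "0 < M" "2 * M \<le> 2 * R"
  shows "(if even a then if a = 0 then 1 else a - 1 else a) +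
    (if even b then if b = 0 then 1 else b - 1 else b) \<le> 2 * R - 2"
proof -
  have "2 \<le> M" using assms by presburger
  then show ?thesis using assms by auto
qed

text \<open>The coefficient \<open>c\<close> is \<open>1\<close>, \<open>2\<close>, \<open>0\<close> for type B, C, D respectively.\<close>

locale classical_coordinates =
  fixes \<Phi> :: "'v::euclidean_space dual set" and \<epsilon> :: "nat \<Rightarrow> 'v dual" and n :: nat
    and c :: int and p :: 'v
  assumes basis: "indexed_basis n \<epsilon>" and n: "2 \<le> n" and c: "c = 0 \<or> c = 1 \<or> c = 2"
    and \<Phi>: "\<Phi> = roots_D n \<epsilon> \<union>
      (if c = 0 then {} else (\<Union>i<n. {of_int c *\<^sub>R \<epsilon> i, - (of_int c *\<^sub>R \<epsilon> i)}))"
begin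

lemma ball_roots:
  "(\<forall>a\<in>\<Phi>. P a) \<longleftrightarrow>
     (\<forall>i<n. \<forall>j<n. i \<noteq> j \<longrightarrow> P (\<epsilon> i + \<epsilon> j) \<and> P (\<epsilon> i - \<epsilon> j) \<and> P (- \<epsilon> i - \<epsilon> j)) \<and>
     (c \<noteq> 0 \<longrightarrow> (\<forall>i<n. P (of_int c *\<^sub>R \<epsilon> i) \<and> P (- (of_int c *\<^sub>R \<epsilon> i))))"
  unfolding \<Phi> roots_D_def by auto

lemma finite_roots: "finite \<Phi>"
  unfolding \<Phi> roots_D_def by auto

lemma pair_roots:
  assumes "i < n" "j < n" "i \<noteq> j"
  shows "\<epsilon> i + \<epsilon> j \<in> \<Phi>" "\<epsilon> i - \<epsilon> j \<in> \<Phi>"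
  using assms unfolding \<Phi> roots_D_def by auto

section \<open>Vertices in standard coordinates\<close>

definition coord :: "'v \<Rightarrow> nat \<Rightarrow> real" where
  "coord x i = blinfun_apply (\<epsilon> i) (x - p)"

lemma ex_point: "\<exists>y. \<forall>i<n. coord y i = f i"
proof -
  obtain v where "\<forall>i<n. blinfun_apply (\<epsilon> i) v = f i"
    using ex_vector_with_coordinates[OF basis] by blast
  then show ?thesis by (intro exI[of _ "p + v"]) (simp add: coord_def)
qed

lemma eqI: "(\<And>i. i < n \<Longrightarrow> blinfun_apply (\<epsilon> i) v = blinfun_apply (\<epsilon> i) w) \<Longrightarrow> v = w"
  using coordinates_eq_0[OF basis, of "v - w"] by (simp add: blinfun.diff_right)

lemma apply_root:
  "blinfun_apply (\<epsilon> i + \<epsilon> j) (x - p) = coord x i + coord x j"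
  "blinfun_apply (\<epsilon> i - \<epsilon> j) (x - p) = coord x i - coord x j"
  "blinfun_apply (- \<epsilon> i - \<epsilon> j) (x - p) = - (coord x i + coord x j)"
  "blinfun_apply (r *\<^sub>R \<epsilon> i) (x - p) = r * coord x i"
  "blinfun_apply (- (r *\<^sub>R \<epsilon> i)) (x - p) = - (r * coord x i)"
  by (simp_all add: coord_def blinfun.add_left blinfun.diff_left blinfun.minus_left blinfun.scaleR_left)

lemma vertexD:
  fixes u :: "nat \<Rightarrow> real"
  assumes "vertex \<Phi> p x"
    and "\<And>i j. i < n \<Longrightarrow> j < n \<Longrightarrow> i \<noteq> j \<Longrightarrow> coord x i + coord x j \<in> \<int> \<Longrightarrow> u i + u j = 0"
    and "\<And>i j. i < n \<Longrightarrow> j < n \<Longrightarrow> i \<noteq> j \<Longrightarrow> coord x i - coord x j \<in> \<int> \<Longrightarrow> u i = u j"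
    and "\<And>i. i < n \<Longrightarrow> c \<noteq> 0 \<Longrightarrow> of_int c * coord x i \<in> \<int> \<Longrightarrow> u i = 0"
    and "i < n"
  shows "u i = 0"
proof -
  obtain v where v: "\<forall>i<n. blinfun_apply (\<epsilon> i) v = u i"
    using ex_vector_with_coordinates[OF basis] by blast
  have "\<forall>a\<in>\<Phi>. blinfun_apply a (x - p) \<in> \<int> \<longrightarrow> blinfun_apply a v = 0"
    unfolding ball_roots apply_root minus_in_Ints_iff
  proof (intro conjI allI impI)
    fix i j assume ij: "i < n" "j < n" "i \<noteq> j"
    show "blinfun_apply (\<epsilon> i + \<epsilon> j) v = 0" "blinfun_apply (- \<epsilon> i - \<epsilon> j) v = 0"
      if "coord x i + coord x j \<in> \<int>"
      using assms(2)[OF ij that] v ij by (simp_all add: blinfun.add_left blinfun.diff_left blinfun.minus_left)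
    show "blinfun_apply (\<epsilon> i - \<epsilon> j) v = 0" if "coord x i - coord x j \<in> \<int>"
      using assms(3)[OF ij that] v ij by (simp add: blinfun.diff_left)
  next
    fix i assume i: "c \<noteq> 0" "i < n" "of_int c * coord x i \<in> \<int>"
    show "blinfun_apply (of_int c *\<^sub>R \<epsilon> i) v = 0" "blinfun_apply (- (of_int c *\<^sub>R \<epsilon> i)) v = 0"
      using assms(4)[OF i(2,1,3)] v i by (simp_all add: blinfun.minus_left blinfun.scaleR_left)
  qed
  then have "v = 0" using assms(1) vertex_iff[OF finite_roots] by blast
  then show ?thesis using v assms(5) by (simp add: blinfun.zero_right)
qed

text \<open>Any second index \<open>j\<close> isolates the coordinate \<open>i\<close>. The
  condition says that the coordinates are all integers or all proper half-integers; in type C it is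
  not necessary, as mixed points are vertices too.\<close>

lemma vertexI:
  assumes "\<And>i j. i < n \<Longrightarrow> j < n \<Longrightarrow> i \<noteq> j \<Longrightarrow> coord x i + coord x j \<in> \<int> \<and> coord x i - coord x j \<in> \<int>"
  shows "vertex \<Phi> p x"
  unfolding vertex_iff[OF finite_roots]
proof (intro allI impI eqI)
  fix v i assume v: "\<forall>a\<in>\<Phi>. blinfun_apply a (x - p) \<in> \<int> \<longrightarrow> blinfun_apply a v = 0" and i: "i < n"
  define j where "j = (if i = 0 then 1 else 0 :: nat)"
  have j: "j < n" "i \<noteq> j" using n by (auto simp: j_def)
  have "blinfun_apply (\<epsilon> i + \<epsilon> j) v = 0" "blinfun_apply (\<epsilon> i - \<epsilon> j) v = 0"
    using v pair_roots[OF i j] assms[OF i j] by (simp_all add: apply_root)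
  then show "blinfun_apply (\<epsilon> i) v = blinfun_apply (\<epsilon> i) 0"
    by (simp add: blinfun.add_left blinfun.diff_left blinfun.zero_right)
qed

text \<open>Otherwise the coordinates congruent to \<open>coord x i\<close> or to its negative
  modulo the integers form two disjoint classes. The vector with value 1 on the first, -1 on the
  second and 0 elsewhere is killed by all roots integral at \<open>x\<close>.\<close>

lemma vertex_coord_half_integer:
  assumes "vertex \<Phi> p x" "i < n"
  shows "2 * coord x i \<in> \<int>"
proof (rule ccontr)
  assume no: "2 * coord x i \<notin> \<int>"
  let ?X = "coord x"
  define u :: "nat \<Rightarrow> real" where
    "u j = (if ?X j - ?X i \<in> \<int> then 1 else if ?X j + ?X i \<in> \<int> then - 1 else 0)" for j
  have excl: "\<not> (?X j - ?X i \<in> \<int> \<and> ?X j + ?X i \<in> \<int>)" for j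
  proof
    assume "?X j - ?X i \<in> \<int> \<and> ?X j + ?X i \<in> \<int>"
    then have "(?X j + ?X i) - (?X j - ?X i) \<in> \<int>" using Ints_diff by blast
    moreover have "(?X j + ?X i) - (?X j - ?X i) = 2 * ?X i" by simp
    ultimately show False using no by metis
  qed
  have "u i = 0"
  proof (rule vertexD[OF assms(1) _ _ _ assms(2)])
    fix j k assume jk: "?X j + ?X k \<in> \<int>"
    have "?X j - ?X i \<in> \<int> \<longleftrightarrow> ?X k + ?X i \<in> \<int>"
      using Ints_diff[OF jk, of "?X j - ?X i"] Ints_diff[OF jk, of "?X k + ?X i"] by (auto simp: algebra_simps)
    moreover have "?X j + ?X i \<in> \<int> \<longleftrightarrow> ?X k - ?X i \<in> \<int>"
      using Ints_diff[OF jk, of "?X j + ?X i"] Ints_diff[OF jk, of "?X k - ?X i"] by (auto simp: algebra_simps)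
    ultimately show "u j + u k = 0" using excl[of j] excl[of k] by (auto simp: u_def)
  next
    fix j k assume jk: "?X j - ?X k \<in> \<int>"
    have "?X j - ?X i \<in> \<int> \<longleftrightarrow> ?X k - ?X i \<in> \<int>"
      using Ints_diff[of "?X j - ?X i", OF _ jk] Ints_add[OF jk, of "?X k - ?X i"] by (auto simp: algebra_simps)
    moreover have "?X j + ?X i \<in> \<int> \<longleftrightarrow> ?X k + ?X i \<in> \<int>"
      using Ints_diff[of "?X j + ?X i", OF _ jk] Ints_add[OF jk, of "?X k + ?X i"] by (auto simp: algebra_simps)
    ultimately show "u j = u k" by (auto simp: u_def)
  next
    fix j assume "c \<noteq> 0" "of_int c * ?X j \<in> \<int>"
    \<comment> \<open>A nonzero \<open>c\<close> divides 2. An index with \<open>2 * ?X j\<close>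
      integral would lie in both classes or in neither, so it lies in neither.\<close>
    then have j: "2 * ?X j \<in> \<int>" using c Ints_mult[of 2 "?X j"] by auto
    show "u j = 0"
      using excl[of j] Ints_diff[OF j, of "?X j - ?X i"] Ints_diff[OF j, of "?X j + ?X i"]
      by (auto simp: u_def algebra_simps)
  qed
  then show False by (simp add: u_def)
qed

section \<open>Edges in standard coordinates\<close>

lemma parity_step:
  fixes N D :: "nat \<Rightarrow> int"
  assumes vx: "vertex \<Phi> p x" and X: "\<And>i. i < n \<Longrightarrow> coord x i = of_int (N i) / 2"
    and m: "m < n" "even (N m) = e" and D: "\<And>i. D i = 1 \<or> D i = - 1"
  shows "\<exists>y. adjacent \<Phi> p x y \<and>
    (\<forall>i<n. coord y i = of_int (if even (N i) = e then N i - D i else N i) / 2)"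
proof -
  define N' where "N' i = (if even (N i) = e then N i - D i else N i)" for i
  obtain y where Y: "\<And>i. i < n \<Longrightarrow> coord y i = of_int (N' i) / 2"
    using ex_point[of "\<lambda>i. of_int (N' i) / 2"] by auto
  \<comment> \<open>The move gives all doubled coordinates the parity of the unmoved class, so all
    sums and differences at \<open>y\<close> are integral.\<close>
  have parity: "even (N' i) = (\<not> e)" for i
    using D[of i] by (auto simp: N'_def)
  have vy: "vertex \<Phi> p y"
  proof (rule vertexI)
    fix i j assume "i < n" "j < n"
    then have "coord y i + coord y j = of_int (N' i + N' j) / 2" "coord y i - coord y j = of_int (N' i - N' j) / 2"
      by (simp_all add: Y)
    then show "coord y i + coord y j \<in> \<int> \<and> coord y i - coord y j \<in> \<int>"
      by (simp only: half_in_Ints_iff) (use parity[of i] parity[of j] in auto)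
  qed
  have yx: "blinfun_apply (\<epsilon> i) (y - x) = (if even (N i) = e then - of_int (D i) / 2 else 0)" if "i < n" for i
  proof -
    have "blinfun_apply (\<epsilon> i) (y - x) = coord y i - coord x i"
      by (simp add: coord_def blinfun.diff_right)
    then show ?thesis using that by (auto simp: X Y N'_def diff_divide_distrib)
  qed
  have ne: "D i \<noteq> 0" for i using D[of i] by auto
  have "adjacent \<Phi> p x y"
  proof (rule adjacentI[OF finite_roots vx vy])
    show "x \<noteq> y" using yx[OF m(1)] m(2) ne by (auto simp: blinfun.zero_right)
  next
    let ?strip = "\<lambda>(u::real) (w::real). \<exists>k::int. of_int k \<le> u \<and> u \<le> of_int k + 1 \<and> of_int k \<le> w \<and> w \<le> of_int k + (1::real)"
    have diff: "\<bar>N i - N' i\<bar> \<le> 1" for i using D[of i] by (auto simp: N'_def)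
    have "\<forall>a\<in>\<Phi>. ?strip (blinfun_apply a (x - p)) (blinfun_apply a (y - p))"
      unfolding ball_roots apply_root
    proof (intro conjI allI impI)
      fix i j assume ij: "i < n" "j < n" "i \<noteq> j"
      \<comment> \<open>A doubled root value changes by two only if both coordinates are moved; they
        then have equal parity, so the root starts at a wall.\<close>
      have *: "\<bar>(s * N i + t * N j) - (s * N' i + t * N' j)\<bar> \<le> 1 \<or>
          (\<bar>(s * N i + t * N j) - (s * N' i + t * N' j)\<bar> \<le> 2 \<and> even (s * N i + t * N j))"
        if st: "s = 1 \<or> s = -1" "t = 1 \<or> t = -1" for s t
      proof (cases "even (N i) = even (N j)")
        case True
        then have "even (s * N i + t * N j)" using st by auto
        then show ?thesis using diff[of i] diff[of j] st by auto
      next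
        case False
        then have "N i = N' i \<or> N j = N' j" by (auto simp: N'_def)
        then show ?thesis using diff[of i] diff[of j] st by auto
      qed
      show "?strip (coord x i + coord x j) (coord y i + coord y j)"
        using strip_half_integers[OF *[of 1 1]] by (simp add: X Y ij add_divide_distrib)
      show "?strip (coord x i - coord x j) (coord y i - coord y j)"
        using strip_half_integers[OF *[of 1 "-1"]] by (simp add: X Y ij diff_divide_distrib)
      show "?strip (- (coord x i + coord x j)) (- (coord y i + coord y j))"
        using strip_half_integers[OF *[of "-1" "-1"]] by (simp add: X Y ij add_divide_distrib diff_divide_distrib)
    next
      fix i assume i: "c \<noteq> 0" "i < n"
      \<comment> \<open>A change by two occurs only for \<open>c = 2\<close>, and then the doubled
        value \<open>2 * N i\<close> is even.\<close>
      have *: "\<bar>s * c * N i - s * c * N' i\<bar> \<le> 1 \<or> (\<bar>s * c * N i - s * c * N' i\<bar> \<le> 2 \<and> even (s * c * N i))"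
        if "s = 1 \<or> s = -1" for s
        using c i(1) diff[of i] that by auto
      show "?strip (of_int c * coord x i) (of_int c * coord y i)"
        using strip_half_integers[OF *[of 1]] by (simp add: X Y i)
      show "?strip (- (of_int c * coord x i)) (- (of_int c * coord y i))"
        using strip_half_integers[OF *[of "-1"]] by (simp add: X Y i)
    qed
    then show "\<And>a. a \<in> \<Phi> \<Longrightarrow> ?strip (blinfun_apply a (x - p)) (blinfun_apply a (y - p))" by blast
  next
    fix v assume v: "\<And>a. a \<in> \<Phi> \<Longrightarrow> blinfun_apply a (x - p) \<in> \<int> \<Longrightarrow>
        blinfun_apply a (y - x) = 0 \<Longrightarrow> blinfun_apply a v = 0"
    let ?u = "\<lambda>i. blinfun_apply (\<epsilon> i) v"
    have plus: "?u i + ?u j = 0"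
      if "i < n" "j < n" "i \<noteq> j" "coord x i + coord x j \<in> \<int>"
        "blinfun_apply (\<epsilon> i) (y - x) + blinfun_apply (\<epsilon> j) (y - x) = 0" for i j
      using v[OF pair_roots(1)[OF that(1-3)]] that(4,5) unfolding apply_root by (simp add: blinfun.add_left)
    have minus: "?u i = ?u j"
      if "i < n" "j < n" "i \<noteq> j" "coord x i - coord x j \<in> \<int>"
        "blinfun_apply (\<epsilon> i) (y - x) = blinfun_apply (\<epsilon> j) (y - x)" for i j
      using v[OF pair_roots(2)[OF that(1-3)]] that(4,5) unfolding apply_root by (simp add: blinfun.diff_left)
    have single: "?u i = 0"
      if "i < n" "c \<noteq> 0" "of_int c * coord x i \<in> \<int>" "blinfun_apply (\<epsilon> i) (y - x) = 0" for i
    proof -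
      have "of_int c *\<^sub>R \<epsilon> i \<in> \<Phi>" using that ball_roots[of "\<lambda>a. a \<in> \<Phi>"] by blast
      from v[OF this] show ?thesis
        using that unfolding apply_root by (simp add: blinfun.scaleR_left)
    qed
    have sum_Ints: "coord x i + coord x j \<in> \<int> \<longleftrightarrow> even (N i) = even (N j)"
      and diff_Ints: "coord x i - coord x j \<in> \<int> \<longleftrightarrow> even (N i) = even (N j)" if "i < n" "j < n" for i j
    proof -
      have "coord x i + coord x j = of_int (N i + N j) / 2" "coord x i - coord x j = of_int (N i - N j) / 2"
        using that by (simp_all add: X)
      then show "coord x i + coord x j \<in> \<int> \<longleftrightarrow> even (N i) = even (N j)"
        "coord x i - coord x j \<in> \<int> \<longleftrightarrow> even (N i) = even (N j)"
        by (simp_all only: half_in_Ints_iff) auto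
    qed
    \<comment> \<open>Setting the moved coordinates of \<open>v\<close> to zero gives a vector killed by all integral roots at
      the vertex \<open>x\<close>.\<close>
    have fixed: "?u i = 0" if "i < n" "even (N i) \<noteq> e" for i
    proof -
      have "(if even (N i) = e then 0 else ?u i) = 0"
      proof (rule vertexD[OF vx, where u="\<lambda>i. if even (N i) = e then 0 else ?u i", OF _ _ _ that(1)])
        fix i j assume *: "i < n" "j < n" "i \<noteq> j" "coord x i + coord x j \<in> \<int>"
        then show "(if even (N i) = e then 0 else ?u i) + (if even (N j) = e then 0 else ?u j) = 0"
          using plus[OF *] yx[of i] yx[of j] by (auto simp: sum_Ints)
      next
        fix i j assume *: "i < n" "j < n" "i \<noteq> j" "coord x i - coord x j \<in> \<int>"
        then show "(if even (N i) = e then 0 else ?u i) = (if even (N j) = e then 0 else ?u j)"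
          using minus[OF *] yx[of i] yx[of j] by (auto simp: diff_Ints)
      next
        fix i assume *: "i < n" "c \<noteq> 0" "of_int c * coord x i \<in> \<int>"
        then show "(if even (N i) = e then 0 else ?u i) = 0"
          using single[OF *] yx[of i] by auto
      qed
      then show ?thesis using that by simp
    qed
    \<comment> \<open>The root tying \<open>i\<close> to \<open>m\<close> is their difference when
      both move in the same direction and their sum when they move oppositely.\<close>
    have moved: "?u i = of_int (D i * D m) * ?u m" if "i < n" "even (N i) = e" for i
    proof (cases "i = m")
      case True then show ?thesis using D[of i] by auto
    next
      case False
      have *: "even (N i) = even (N m)" using that m by simp
      show ?thesis
      proof (cases "D i = D m")
        case True
        then have "?u i = ?u m" using minus[OF that(1) m(1) False] * that m yx by (simp add: diff_Ints)
        then show ?thesis using True D[of m] by auto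
      next
        case neq: False
        then have "D i = - D m" using D[of i] D[of m] by auto
        then have "?u i + ?u m = 0" using plus[OF that(1) m(1) False] * that m yx by (simp add: sum_Ints)
        then show ?thesis using \<open>D i = - D m\<close> D[of m] by auto
      qed
    qed
    \<comment> \<open>The coordinate \<open>m\<close> of \<open>y - x\<close> is
      \<open>- D m / 2\<close>, and \<open>D m\<close> is its own inverse.\<close>
    have "v = (- 2 * of_int (D m) * ?u m) *\<^sub>R (y - x)"
    proof (rule eqI)
      fix i assume "i < n"
      then show "?u i = blinfun_apply (\<epsilon> i) ((- 2 * of_int (D m) * ?u m) *\<^sub>R (y - x))"
        unfolding blinfun.scaleR_right yx[OF \<open>i < n\<close>]
        by (cases "even (N i) = e") (simp_all add: fixed moved)
    qed
    then show "\<exists>c. v = c *\<^sub>R (y - x)" by blast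
  qed
  then show ?thesis using Y unfolding N'_def by blast
qed

lemma shrink_step:
  fixes N :: "nat \<Rightarrow> int"
  assumes "vertex \<Phi> p x" "\<And>i. i < n \<Longrightarrow> coord x i = of_int (N i) / 2" "m < n" "even (N m) = e"
  shows "\<exists>y L. adjacent \<Phi> p x y \<and> (\<forall>i<n. coord y i = of_int (L i) / 2) \<and>
    (\<forall>i. \<bar>L i\<bar> = (if even (N i) = e then if N i = 0 then 1 else \<bar>N i\<bar> - 1 else \<bar>N i\<bar>))"
proof -
  \<comment> \<open>At zero the direction is a free choice; with \<open>- 1\<close> the coordinate
    becomes \<open>1/2\<close>.\<close>
  define D :: "nat \<Rightarrow> int" where "D i = (if N i > 0 then 1 else - 1)" for i
  have "D i = 1 \<or> D i = - 1" for i by (simp add: D_def)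
  from parity_step[OF assms this] obtain y where y: "adjacent \<Phi> p x y \<and>
    (\<forall>i<n. coord y i = of_int (if even (N i) = e then N i - D i else N i) / 2)" by (rule exE)
  have "\<bar>if even (N i) = e then N i - D i else N i\<bar> =
      (if even (N i) = e then if N i = 0 then 1 else \<bar>N i\<bar> - 1 else \<bar>N i\<bar>)" for i
    by (auto simp: D_def)
  then have "\<forall>i. \<bar>if even (N i) = e then N i - D i else N i\<bar> =
      (if even (N i) = e then if N i = 0 then 1 else \<bar>N i\<bar> - 1 else \<bar>N i\<bar>)" ..
  from conjI[OF conjunct1[OF y] conjI[OF conjunct2[OF y] this]] show ?thesis
    by (intro exI[of _ y] exI[of _ "\<lambda>i. if even (N i) = e then N i - D i else N i"])
qed

text \<open>For \<open>c = 2\<close> the root \<open>2 *\<^sub>R \<epsilon> m\<close> would change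
  by two and the step would cross a wall. With three indices, every unmoved coordinate has an
  unmoved partner, and the sum and difference of the two pin it.\<close>

lemma unit_step:
  fixes M :: "nat \<Rightarrow> int"
  assumes n3: "3 \<le> n" and c2: "c \<noteq> 2" and vx: "vertex \<Phi> p x"
    and X: "\<And>i. i < n \<Longrightarrow> coord x i = of_int (M i)"
    and m: "m < n" and d: "d = 1 \<or> d = - 1"
  shows "\<exists>y. adjacent \<Phi> p x y \<and> (\<forall>i<n. coord y i = of_int (if i = m then M i - d else M i))"
proof -
  define M' where "M' i = (if i = m then M i - d else M i)" for i
  obtain y where Y: "\<And>i. i < n \<Longrightarrow> coord y i = of_int (M' i)"
    using ex_point[of "\<lambda>i. of_int (M' i)"] by auto
  have vy: "vertex \<Phi> p y" by (rule vertexI) (simp add: Y)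
  have yx: "blinfun_apply (\<epsilon> i) (y - x) = (if i = m then - of_int d else 0)" if "i < n" for i
  proof -
    have "blinfun_apply (\<epsilon> i) (y - x) = coord y i - coord x i"
      by (simp add: coord_def blinfun.diff_right)
    then show ?thesis using that by (simp add: X Y M'_def)
  qed
  have "adjacent \<Phi> p x y"
  proof (rule adjacentI[OF finite_roots vx vy])
    show "x \<noteq> y" using yx[OF m] d by (auto simp: blinfun.zero_right)
  next
    let ?strip = "\<lambda>(u::real) (w::real). \<exists>k::int. of_int k \<le> u \<and> u \<le> of_int k + 1 \<and> of_int k \<le> w \<and> w \<le> of_int k + (1::real)"
    have strip: "?strip u w" if "u = of_int A" "w = of_int B" "\<bar>A - B\<bar> \<le> 1" for u w A B
      using that by (intro exI[of _ "min A B"]) (auto simp: min_def)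
    have "\<forall>a\<in>\<Phi>. ?strip (blinfun_apply a (x - p)) (blinfun_apply a (y - p))"
      unfolding ball_roots apply_root
    proof (intro conjI allI impI)
      fix i j assume ij: "i < n" "j < n" "i \<noteq> j"
      show "?strip (coord x i + coord x j) (coord y i + coord y j)"
        by (rule strip[of _ "M i + M j" _ "M' i + M' j"]) (use d ij(3) in \<open>auto simp: X Y ij(1,2) M'_def\<close>)
      show "?strip (coord x i - coord x j) (coord y i - coord y j)"
        by (rule strip[of _ "M i - M j" _ "M' i - M' j"]) (use d ij(3) in \<open>auto simp: X Y ij(1,2) M'_def\<close>)
      show "?strip (- (coord x i + coord x j)) (- (coord y i + coord y j))"
        by (rule strip[of _ "- (M i + M j)" _ "- (M' i + M' j)"]) (use d ij(3) in \<open>auto simp: X Y ij(1,2) M'_def\<close>)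
    next
      fix i assume i: "c \<noteq> 0" "i < n"
      have "c = 1" using c c2 i by blast
      show "?strip (of_int c * coord x i) (of_int c * coord y i)"
        by (rule strip[of _ "M i" _ "M' i"]) (use d in \<open>auto simp: X Y i \<open>c = 1\<close> M'_def\<close>)
      show "?strip (- (of_int c * coord x i)) (- (of_int c * coord y i))"
        by (rule strip[of _ "- M i" _ "- M' i"]) (use d in \<open>auto simp: X Y i \<open>c = 1\<close> M'_def\<close>)
    qed
    then show "\<And>a. a \<in> \<Phi> \<Longrightarrow> ?strip (blinfun_apply a (x - p)) (blinfun_apply a (y - p))" by blast
  next
    fix v assume v: "\<And>a. a \<in> \<Phi> \<Longrightarrow> blinfun_apply a (x - p) \<in> \<int> \<Longrightarrow>
        blinfun_apply a (y - x) = 0 \<Longrightarrow> blinfun_apply a v = 0"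
    have zero: "blinfun_apply (\<epsilon> i) v = 0" if i: "i < n" "i \<noteq> m" for i
    proof -
      \<comment> \<open>An index among 0, 1, 2 different from both \<open>i\<close> and
        \<open>m\<close>.\<close>
      define j where "j = (if i \<noteq> 0 \<and> m \<noteq> 0 then 0 else if i \<noteq> 1 \<and> m \<noteq> 1 then 1 else 2 :: nat)"
      have j: "j < n" "j \<noteq> m" "i \<noteq> j" using n3 by (auto simp: j_def)
      have "blinfun_apply (\<epsilon> i + \<epsilon> j) v = 0"
        using v[OF pair_roots(1)[OF i(1) j(1,3)]] unfolding apply_root
        by (simp add: X i j yx blinfun.add_left)
      moreover have "blinfun_apply (\<epsilon> i - \<epsilon> j) v = 0"
        using v[OF pair_roots(2)[OF i(1) j(1,3)]] unfolding apply_root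
        by (simp add: X i j yx blinfun.diff_left)
      ultimately show ?thesis by (simp add: blinfun.add_left blinfun.diff_left)
    qed
    have "v = (- of_int d * blinfun_apply (\<epsilon> m) v) *\<^sub>R (y - x)"
    proof (rule eqI)
      fix i assume "i < n"
      then show "blinfun_apply (\<epsilon> i) v = blinfun_apply (\<epsilon> i) ((- of_int d * blinfun_apply (\<epsilon> m) v) *\<^sub>R (y - x))"
        unfolding blinfun.scaleR_right yx[OF \<open>i < n\<close>] using d by (auto simp: zero)
    qed
    then show "\<exists>c. v = c *\<^sub>R (y - x)" by blast
  qed
  then show ?thesis using Y unfolding M'_def by blast
qed

section \<open>Lowering the bound by one\<close>

lemma bounded_iff:
  "(\<forall>a\<in>\<Phi>. blinfun_apply a (x - p) \<le> r) \<longleftrightarrow>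
     (\<forall>i<n. \<forall>j<n. i \<noteq> j \<longrightarrow> \<bar>coord x i\<bar> + \<bar>coord x j\<bar> \<le> r) \<and>
     (c \<noteq> 0 \<longrightarrow> (\<forall>i<n. of_int c * \<bar>coord x i\<bar> \<le> r))"
proof -
  have pair: "(\<forall>i<n. \<forall>j<n. i \<noteq> j \<longrightarrow> coord x i + coord x j \<le> r \<and> coord x i - coord x j \<le> r
        \<and> - (coord x i + coord x j) \<le> r) \<longleftrightarrow>
      (\<forall>i<n. \<forall>j<n. i \<noteq> j \<longrightarrow> \<bar>coord x i\<bar> + \<bar>coord x j\<bar> \<le> r)" (is "?L \<longleftrightarrow> ?R")
  proof
    assume L: ?L
    show ?R
    proof (intro allI impI)
      fix i j assume "i < n" "j < n" "i \<noteq> j"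
      then have "coord x i + coord x j \<le> r \<and> coord x i - coord x j \<le> r \<and> - (coord x i + coord x j) \<le> r"
        "coord x j - coord x i \<le> r" using L by blast+
      then show "\<bar>coord x i\<bar> + \<bar>coord x j\<bar> \<le> r" by linarith
    qed
  qed fastforce
  have "of_int c * u \<le> r \<and> - (of_int c * u) \<le> r \<longleftrightarrow> of_int c * \<bar>u\<bar> \<le> r" for u :: real
    using c by auto
  then show ?thesis unfolding ball_roots apply_root pair by simp
qed

lemma ex_doubled_coord:
  assumes "vertex \<Phi> p x"
  obtains N :: "nat \<Rightarrow> int" where "\<And>i. i < n \<Longrightarrow> coord x i = of_int (N i) / 2"
proof -
  have "\<forall>i. \<exists>k::int. i < n \<longrightarrow> coord x i = of_int k / 2"
  proof
    fix i
    show "\<exists>k::int. i < n \<longrightarrow> coord x i = of_int k / 2"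
    proof (cases "i < n")
      case True
      then obtain k where "2 * coord x i = of_int k"
        using vertex_coord_half_integer[OF assms] by (meson Ints_cases)
      then show ?thesis by (intro exI[of _ k]) simp
    qed simp
  qed
  then show ?thesis using that by metis
qed

text \<open>The sum of two absolute values is the mean of their doubles, so only the bound on each
  doubled coordinate matters.\<close>

lemma descending_type_C:
  assumes "c = 2"
  shows "descending \<Phi> p"
  unfolding descending_def bounded_iff
proof (intro allI impI)
  fix x and r :: nat
  assume vx: "vertex \<Phi> p x"
    and le: "(\<forall>i<n. \<forall>j<n. i \<noteq> j \<longrightarrow> \<bar>coord x i\<bar> + \<bar>coord x j\<bar> \<le> real (Suc r)) \<and>
     (c \<noteq> 0 \<longrightarrow> (\<forall>i<n. of_int c * \<bar>coord x i\<bar> \<le> real (Suc r)))"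
  obtain N where N: "\<And>i. i < n \<Longrightarrow> coord x i = of_int (N i) / 2"
    using ex_doubled_coord[OF vx] by blast
  have leN: "\<bar>N i\<bar> \<le> int (Suc r)" if "i < n" for i
  proof -
    have "real_of_int \<bar>N i\<bar> \<le> real (Suc r)" using le assms that N by force
    then show ?thesis by linarith
  qed
  \<comment> \<open>Only doubled coordinates of absolute value \<open>r + 1\<close> violate the new
    bound, and all of them have this parity.\<close>
  define e where "e = even (Suc r)"
  have goal: "(\<forall>i<n. \<forall>j<n. i \<noteq> j \<longrightarrow> \<bar>coord y i\<bar> + \<bar>coord y j\<bar> \<le> real r) \<and>
     (c \<noteq> 0 \<longrightarrow> (\<forall>i<n. of_int c * \<bar>coord y i\<bar> \<le> real r))"
    if "\<And>i. i < n \<Longrightarrow> coord y i = of_int (L i) / 2" "\<And>i. i < n \<Longrightarrow> \<bar>L i\<bar> \<le> int r" for y L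
  proof -
    have "2 * \<bar>coord y i\<bar> \<le> real r" if "i < n" for i
    proof -
      have "real_of_int \<bar>L i\<bar> \<le> real r" using \<open>\<And>i. i < n \<Longrightarrow> \<bar>L i\<bar> \<le> int r\<close>[OF that] by linarith
      then show ?thesis unfolding \<open>\<And>i. i < n \<Longrightarrow> coord y i = of_int (L i) / 2\<close>[OF that] by simp
    qed
    moreover from this have "\<bar>coord y i\<bar> + \<bar>coord y j\<bar> \<le> real r" if "i < n" "j < n" for i j
      using that by (smt (verit))
    ultimately show ?thesis using assms by simp
  qed
  show "\<exists>y. (y = x \<or> adjacent \<Phi> p x y) \<and>
     (\<forall>i<n. \<forall>j<n. i \<noteq> j \<longrightarrow> \<bar>coord y i\<bar> + \<bar>coord y j\<bar> \<le> real r) \<and>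
     (c \<noteq> 0 \<longrightarrow> (\<forall>i<n. of_int c * \<bar>coord y i\<bar> \<le> real r))"
  proof (cases "\<exists>m<n. even (N m) = e")
    case True
    then obtain m where m: "m < n" "even (N m) = e" by blast
    obtain y L where y: "adjacent \<Phi> p x y" "\<forall>i<n. coord y i = of_int (L i) / 2"
      and L: "\<forall>i. \<bar>L i\<bar> = (if even (N i) = e then if N i = 0 then 1 else \<bar>N i\<bar> - 1 else \<bar>N i\<bar>)"
      using shrink_step[OF vx N m] by metis
    have "\<bar>L i\<bar> \<le> int r" if "i < n" for i
    proof (cases "\<bar>N i\<bar> = int (Suc r)")
      case True
      then have "even (N i) = e" unfolding e_def by (metis abs_dvd_iff dvd_abs_iff even_of_nat)
      then show ?thesis using L True by auto
    next
      case False
      then have "\<bar>N i\<bar> \<le> int r" using leN[OF that] by linarith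
      \<comment> \<open>A zero is raised to one only if \<open>r + 1\<close> is even, which excludes
        \<open>r = 0\<close>.\<close>
      moreover have "1 \<le> r" if "N i = 0" "even (N i) = e" using that by (cases r) (auto simp: e_def)
      ultimately show ?thesis using L by auto
    qed
    with goal y show ?thesis by blast
  next
    case False
    have "\<bar>N i\<bar> \<le> int r" if "i < n" for i
    proof -
      have "even (N i) \<noteq> even (Suc r)" using False that unfolding e_def by blast
      then have "\<bar>N i\<bar> \<noteq> int (Suc r)" by (metis abs_dvd_iff dvd_abs_iff even_of_nat)
      then show ?thesis using leN[OF that] by linarith
    qed
    with goal N show ?thesis by blast
  qed
qed

lemma descending_type_BD:
  assumes c2: "c \<noteq> 2" and n3: "3 \<le> n"
  shows "descending \<Phi> p"
  unfolding descending_def bounded_iff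
proof (intro allI impI)
  fix x and r :: nat
  assume vx: "vertex \<Phi> p x"
    and le: "(\<forall>i<n. \<forall>j<n. i \<noteq> j \<longrightarrow> \<bar>coord x i\<bar> + \<bar>coord x j\<bar> \<le> real (Suc r)) \<and>
     (c \<noteq> 0 \<longrightarrow> (\<forall>i<n. of_int c * \<bar>coord x i\<bar> \<le> real (Suc r)))"
  obtain N where N: "\<And>i. i < n \<Longrightarrow> coord x i = of_int (N i) / 2"
    using ex_doubled_coord[OF vx] by blast
  have leN: "\<bar>N i\<bar> + \<bar>N j\<bar> \<le> 2 * (int r + 1)" if "i < n" "j < n" "i \<noteq> j" for i j
  proof -
    have "\<bar>coord x i\<bar> + \<bar>coord x j\<bar> \<le> real (Suc r)" using le that by blast
    then have "real_of_int (\<bar>N i\<bar> + \<bar>N j\<bar>) \<le> real_of_int (2 * (int r + 1))" using that N by simp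
    then show ?thesis by (simp only: of_int_le_iff)
  qed
  let ?goal = "\<exists>y. (y = x \<or> adjacent \<Phi> p x y) \<and>
     (\<forall>i<n. \<forall>j<n. i \<noteq> j \<longrightarrow> \<bar>coord y i\<bar> + \<bar>coord y j\<bar> \<le> real r) \<and>
     (c \<noteq> 0 \<longrightarrow> (\<forall>i<n. of_int c * \<bar>coord y i\<bar> \<le> real r))"
  have goal: ?goal
    if "y = x \<or> adjacent \<Phi> p x y" and y: "\<And>i. i < n \<Longrightarrow> coord y i = of_int (L i) / 2"
      and L: "\<And>i j. i < n \<Longrightarrow> j < n \<Longrightarrow> i \<noteq> j \<Longrightarrow> \<bar>L i\<bar> + \<bar>L j\<bar> \<le> 2 * int r" for y L
  proof -
    have pair: "\<bar>coord y i\<bar> + \<bar>coord y j\<bar> \<le> real r" if "i < n" "j < n" "i \<noteq> j" for i j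
    proof -
      have "real_of_int (\<bar>L i\<bar> + \<bar>L j\<bar>) \<le> real_of_int (2 * int r)" using L[OF that] by (simp only: of_int_le_iff)
      then show ?thesis using that by (simp add: y)
    qed
    \<comment> \<open>The roots \<open>\<epsilon> i\<close> of type B add no constraint: a pair
      containing \<open>i\<close> already bounds this coordinate.\<close>
    have "\<bar>coord y i\<bar> \<le> real r" if "i < n" for i
    proof -
      have "(if i = 0 then 1 else 0) < n" "i \<noteq> (if i = 0 then 1 else 0)" using n3 by auto
      from pair[OF that this] show ?thesis by linarith
    qed
    then have "c \<noteq> 0 \<longrightarrow> (\<forall>i<n. of_int c * \<bar>coord y i\<bar> \<le> real r)" using c c2 by auto
    then show ?thesis using that(1) pair by blast
  qed
  have shrink: ?goal
    if mN: "m < n" "even (N m) = e"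
      and L: "\<And>i j L. i < n \<Longrightarrow> j < n \<Longrightarrow> i \<noteq> j \<Longrightarrow>
        (\<And>i. L i = (if even (N i) = e then if N i = 0 then 1 else \<bar>N i\<bar> - 1 else \<bar>N i\<bar>)) \<Longrightarrow> L i + L j \<le> 2 * int r"
    for m e
  proof -
    obtain y K where y: "adjacent \<Phi> p x y" "\<forall>i<n. coord y i = of_int (K i) / 2"
      and K: "\<forall>i. \<bar>K i\<bar> = (if even (N i) = e then if N i = 0 then 1 else \<bar>N i\<bar> - 1 else \<bar>N i\<bar>)"
      using shrink_step[OF vx N mN] by metis
    have "\<bar>K i\<bar> + \<bar>K j\<bar> \<le> 2 * int r" if "i < n" "j < n" "i \<noteq> j" for i j
      using L[OF that, of "\<lambda>i. \<bar>K i\<bar>"] K by blast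
    then show ?goal using goal[of y K] y by blast
  qed
  define mx where "mx = Max ((\<lambda>i. \<bar>N i\<bar>) ` {..<n})"
  have "mx \<in> (\<lambda>i. \<bar>N i\<bar>) ` {..<n}" unfolding mx_def using n3 by (intro Max_in) (auto simp: lessThan_empty_iff)
  then obtain m where m: "m < n" "\<bar>N m\<bar> = mx" by auto
  have max: "\<bar>N i\<bar> \<le> \<bar>N m\<bar>" if "i < n" for i using that m(2) by (simp add: mx_def)
  have bm: "\<bar>N m\<bar> + \<bar>N i\<bar> \<le> 2 * (int r + 1)" if "i < n" "i \<noteq> m" for i
    using leN[of m i] m(1) that by auto
  have bm': "\<bar>N i\<bar> = \<bar>N m\<bar> \<or> \<bar>N m\<bar> + \<bar>N i\<bar> \<le> 2 * (int r + 1)" if "i < n" for i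
    using bm[OF that] by blast
  \<comment> \<open>The parity class of a largest entry is moved. A raised zero can spoil this only
    when that class is even; an odd entry or a second largest entry leaves enough room, and the last
    case needs the unit step.\<close>
  consider (odd) "odd (N m)" | (mixed) h where "even (N m)" "h < n" "odd (N h)"
    | (tie) h where "even (N m)" "\<forall>i<n. even (N i)" "h < n" "h \<noteq> m" "\<bar>N h\<bar> = \<bar>N m\<bar>"
    | (unique) "\<forall>i<n. even (N i)" "\<forall>i<n. i \<noteq> m \<longrightarrow> \<bar>N i\<bar> < \<bar>N m\<bar>"
    using max m(1) by (metis order_le_less)
  then show ?goal
  proof cases
    case odd
    show ?thesis
    proof (rule shrink[of m False])
      fix i j L assume ij: "i < n" "j < n" "i \<noteq> j"
        and L: "\<And>i. L i = (if even (N i) = False then if N i = 0 then 1 else \<bar>N i\<bar> - 1 else \<bar>N i\<bar>)"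
      have *: "L k = (if even (N k) then \<bar>N k\<bar> else \<bar>N k\<bar> - 1)" for k using L[of k] by auto
      show "L i + L j \<le> 2 * int r"
        using shrink_odd[OF max[OF ij(1)] max[OF ij(2)] leN[OF ij] _ bm'[OF ij(1)]] odd
        by (simp add: *)
    qed (use odd m in auto)
  next
    case mixed
    have "\<bar>N m\<bar> + \<bar>N h\<bar> \<le> 2 * (int r + 1)" using bm mixed by blast
    show ?thesis
    proof (rule shrink[of m True])
      fix i j L assume ij: "i < n" "j < n" "i \<noteq> j"
        and L: "\<And>i. L i = (if even (N i) = True then if N i = 0 then 1 else \<bar>N i\<bar> - 1 else \<bar>N i\<bar>)"
      show "L i + L j \<le> 2 * int r"
        using shrink_even_mixed[OF max[OF ij(1)] max[OF ij(2)] max[OF mixed(2)] abs_ge_zero leN[OF ij] _ _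
            \<open>\<bar>N m\<bar> + \<bar>N h\<bar> \<le> 2 * (int r + 1)\<close> bm'[OF ij(2)]] mixed(1,3)
        by (simp add: L cong: if_cong split del: if_split)
    qed (use mixed m in auto)
  next
    case tie
    show ?thesis
    proof (cases "N m = 0")
      case True
      then have "N i = 0" if "i < n" for i using max that by fastforce
      then show ?thesis using goal[of x N] N by auto
    next
      case False
      have "2 * \<bar>N m\<bar> \<le> 2 * (int r + 1)" using bm[OF tie(3,4)] tie by simp
      show ?thesis
      proof (rule shrink[of m True])
        fix i j L assume ij: "i < n" "j < n" "i \<noteq> j"
          and L: "\<And>i. L i = (if even (N i) = True then if N i = 0 then 1 else \<bar>N i\<bar> - 1 else \<bar>N i\<bar>)"
        have ev: "even (N i)" "even (N j)" using tie ij by auto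
        show "L i + L j \<le> 2 * int r"
          using shrink_even_tie[OF max[OF ij(1)] max[OF ij(2)] _ _ _ _ \<open>2 * \<bar>N m\<bar> \<le> 2 * (int r + 1)\<close>]
            ev tie(1) False
          by (simp add: L cong: if_cong split del: if_split)
      qed (use tie m in auto)
    qed
  next
    case unique
    define j where "j = (if m = 0 then 1 else 0 :: nat)"
    have "j < n" "j \<noteq> m" using n3 by (auto simp: j_def)
    then have "N m \<noteq> 0" using unique(2) by fastforce
    define M where "M i = N i div 2" for i
    have NM: "N i = 2 * M i" if "i < n" for i using that unique by (simp add: M_def)
    then have XM: "coord x i = of_int (M i)" if "i < n" for i using that N by simp
    define L where "L i = 2 * (if i = m then M i - sgn (M m) else M i)" for i
    have "M m \<noteq> 0" using NM[OF m(1)] \<open>N m \<noteq> 0\<close> by simp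
    then have "sgn (M m) = 1 \<or> sgn (M m) = - 1" by (simp add: sgn_if)
    from unit_step[OF n3 c2 vx XM m(1) this] obtain y where y: "adjacent \<Phi> p x y"
      "\<forall>i<n. coord y i = of_int (L i) / 2" unfolding L_def by auto
    have Lm: "\<bar>L m\<bar> = \<bar>N m\<bar> - 2" using \<open>M m \<noteq> 0\<close> NM[OF m(1)] by (auto simp: L_def sgn_if)
    have Li: "L i = N i" if "i < n" "i \<noteq> m" for i using that NM by (simp add: L_def)
    \<comment> \<open>Equal parity turns the strict inequality into a gap of two, so sums not
      involving \<open>m\<close> already satisfy the new bound.\<close>
    have small: "\<bar>N i\<bar> \<le> \<bar>N m\<bar> - 2" if "i < n" "i \<noteq> m" for i
    proof -
      have "\<bar>N i\<bar> < \<bar>N m\<bar>" "even (N i)" "even (N m)" using unique that m(1) by auto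
      then show ?thesis by presburger
    qed
    have "\<bar>L i\<bar> + \<bar>L k\<bar> \<le> 2 * int r" if "i < n" "k < n" "i \<noteq> k" for i k
      using that small[of i] small[of k] bm[of i] bm[of k] Lm Li[of i] Li[of k]
      by (cases "i = m"; cases "k = m") auto
    then show ?thesis using goal[of y L] y by blast
  qed
qed

end

section \<open>The distance formula\<close>

lemma finite_root_system: "root_system \<Phi> \<Longrightarrow> finite \<Phi>"
  by (simp add: root_system_def)

lemma root_system_uminus:
  assumes "root_system \<Phi>" "a \<in> \<Phi>"
  shows "- a \<in> \<Phi>"
proof -
  obtain h where "is_coroot \<Phi> a h" using assms unfolding root_system_def by blast
  then have "a - 2 *\<^sub>R a \<in> \<Phi>" using assms(2) unfolding is_coroot_def by metis
  then show ?thesis by (simp add: scaleR_2)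
qed

lemma descending_classical_type:
  assumes "finite \<Phi>" "classical_type \<Phi>"
  shows "descending \<Phi> p"
  using assms(2) unfolding classical_type_def
proof (elim disjE exE conjE)
  fix n assume "type_A n \<Phi>"
  then show ?thesis using descending_type_A assms(1) by blast
next
  fix n :: nat assume "3 \<le> n" "type_B n \<Phi>"
  then obtain \<epsilon> where "classical_coordinates \<Phi> \<epsilon> n 1"
    unfolding type_B_def classical_coordinates_def by auto
  then show ?thesis using classical_coordinates.descending_type_BD \<open>3 \<le> n\<close> by fastforce
next
  fix n :: nat assume "2 \<le> n" "type_C n \<Phi>"
  then obtain \<epsilon> where "classical_coordinates \<Phi> \<epsilon> n 2"
    unfolding type_C_def classical_coordinates_def by auto
  then show ?thesis using classical_coordinates.descending_type_C by blast
next
  fix n :: nat assume "4 \<le> n" "type_D n \<Phi>"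
  then obtain \<epsilon> where "classical_coordinates \<Phi> \<epsilon> n 0"
    unfolding type_D_def classical_coordinates_def by auto
  then show ?thesis using classical_coordinates.descending_type_BD \<open>4 \<le> n\<close> by fastforce
qed

section \<open>Special vertices as base points\<close>

lemma proportional_if_kernel_eq:
  fixes a b :: "'v::euclidean_space dual"
  assumes "{v. blinfun_apply b v = 0} = {v. blinfun_apply a v = 0}"
  shows "\<exists>c. b = c *\<^sub>R a"
proof (cases "a = 0")
  case True
  then show ?thesis using assms by (intro exI[of _ 0] blinfun_eqI) auto
next
  case False
  then obtain u where u: "blinfun_apply a u \<noteq> 0" by (metis blinfun_eqI zero_blinfun.rep_eq)
  have eq: "blinfun_apply b v = (blinfun_apply b u / blinfun_apply a u) * blinfun_apply a v" for v
  proof -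
    have "blinfun_apply a (v - (blinfun_apply a v / blinfun_apply a u) *\<^sub>R u) = 0"
      using u by (simp add: blinfun.diff_right blinfun.scaleR_right)
    then have "blinfun_apply b (v - (blinfun_apply a v / blinfun_apply a u) *\<^sub>R u) = 0" using assms by blast
    then show ?thesis by (simp add: blinfun.diff_right blinfun.scaleR_right)
  qed
  have "b = (blinfun_apply b u / blinfun_apply a u) *\<^sub>R a"
    by (rule blinfun_eqI) (unfold blinfun.scaleR_left real_scaleR_def, rule eq)
  then show ?thesis by (rule exI)
qed

text \<open>A special vertex only provides a wall parallel to each root hyperplane, possibly of
  another root \<open>b\<close>; since the system is reduced, \<open>b\<close> is \<open>a\<close>
  or \<open>- a\<close>.\<close>

lemma special_vertex_integral:
  assumes "root_system \<Phi>" "special_vertex \<Phi> q p" "a \<in> \<Phi>"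
  shows "blinfun_apply a (p - q) \<in> \<int>"
proof -
  obtain b k where b: "b \<in> \<Phi>" "{v. blinfun_apply b v = 0} = {v. blinfun_apply a v = 0}" "p \<in> wall q b k"
    using assms(2,3) unfolding special_vertex_def by blast
  then obtain c where c: "b = c *\<^sub>R a" using proportional_if_kernel_eq by blast
  then have "c = 1 \<or> c = - 1" using assms(1,3) b(1) unfolding root_system_def by blast
  then have "b = a \<or> b = - a" using c by auto
  then have "blinfun_apply a (p - q) = of_int k \<or> blinfun_apply a (p - q) = of_int (- k)"
    using b(3) unfolding wall_def by (auto simp: blinfun.minus_left)
  then show ?thesis by (metis Ints_of_int)
qed

text \<open>Moving the base point by an integral amount only shifts the index \<open>k\<close> of
  the walls of each root.\<close>

lemma facet_change_base:
  assumes "\<And>a. a \<in> \<Phi> \<Longrightarrow> blinfun_apply a (p - q) \<in> \<int>"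
  shows "facet \<Phi> q = facet \<Phi> p"
proof -
  have "(\<forall>k::int. sgn (blinfun_apply a (y - q) - of_int k) = sgn (blinfun_apply a (x - q) - of_int k)) \<longleftrightarrow>
     (\<forall>k::int. sgn (blinfun_apply a (y - p) - of_int k) = sgn (blinfun_apply a (x - p) - of_int k))"
    if "a \<in> \<Phi>" for a x y
  proof -
    obtain l where l: "blinfun_apply a (p - q) = of_int l" using assms \<open>a \<in> \<Phi>\<close> by (meson Ints_cases)
    have *: "blinfun_apply a (z - q) - of_int k = blinfun_apply a (z - p) - of_int (k - l)" for z k
      using l by (simp add: blinfun.diff_right)
    show ?thesis unfolding * by (metis add_diff_cancel_right')
  qed
  then show ?thesis unfolding facet_def by (intro ext) auto
qed

text \<open>The comparison is made coefficient by coefficient on the simple roots, which are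
  nonnegative at \<open>v\<close>. Both expansions are first extended to a common finite
  support.\<close>

lemma highest_root_ge:
  assumes "simple_roots \<Phi> C \<Delta>" "highest_root \<Phi> \<Delta> a0" "a \<in> \<Phi>"
    and v: "\<And>b. b \<in> \<Delta> \<Longrightarrow> 0 \<le> blinfun_apply b v"
  shows "blinfun_apply a v \<le> blinfun_apply a0 v"
proof -
  have \<Delta>: "independent \<Delta>" "span \<Delta> = UNIV" "\<Delta> \<subseteq> \<Phi>"
    using assms(1) unfolding simple_roots_def root_basis_def by auto
  have rep: "blinfun_apply d v = (\<Sum>b | representation \<Delta> d b \<noteq> 0. representation \<Delta> d b * blinfun_apply b v)" for d
  proof -
    have "d = (\<Sum>b | representation \<Delta> d b \<noteq> 0. representation \<Delta> d b *\<^sub>R b)"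
      using sum_nonzero_representation_eq[of \<Delta> d] \<Delta> by simp
    then show ?thesis
      by (metis (mono_tags, lifting) blinfun.scaleR_left blinfun.sum_left real_scaleR_def sum.cong)
  qed
  let ?S = "{b. representation \<Delta> a b \<noteq> 0} \<union> {b. representation \<Delta> a0 b \<noteq> 0}"
  have fin: "finite ?S" by (simp add: finite_representation)
  have S: "?S \<subseteq> \<Delta>" using representation_ne_zero by blast
  have rep': "blinfun_apply d v = (\<Sum>b\<in>?S. representation \<Delta> d b * blinfun_apply b v)" if "d = a \<or> d = a0" for d
    unfolding rep[of d] using fin that by (intro sum.mono_neutral_left) auto
  show ?thesis
    using assms(2,3) S unfolding rep'[of a, simplified] rep'[of a0, simplified] highest_root_def
    by (intro sum_mono mult_right_mono v) auto
qed

lemma nonneg_on_closure_chamber: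
  assumes "simple_roots \<Phi> C \<Delta>" "x \<in> closure ((\<lambda>v. p + v) ` C)" "b \<in> \<Delta>"
  shows "0 \<le> blinfun_apply b (x - p)"
proof -
  have "closed {x. 0 \<le> blinfun_apply b (x - p)}"
    by (intro closed_Collect_le continuous_intros)
  moreover have "(\<lambda>v. p + v) ` C \<subseteq> {x. 0 \<le> blinfun_apply b (x - p)}"
    using assms(1,3) unfolding simple_roots_def by (auto intro: less_imp_le)
  ultimately show ?thesis using closure_minimal assms(2) by blast
qed

theorem theorem1p4:
  fixes \<Phi> \<Delta> :: "'v::euclidean_space dual set"
    and q p x :: 'v and C :: "'v set" and a0 :: "'v dual" and r :: nat
  assumes "irreducible_root_system \<Phi>" and "classical_type \<Phi>"
    and "special_vertex \<Phi> q p"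
    and "weyl_chamber \<Phi> C" and "simple_roots \<Phi> C \<Delta>" and "highest_root \<Phi> \<Delta> a0"
    and "vertex \<Phi> q x" and "x \<in> closure ((\<lambda>v. p + v) ` C)"
  shows "vertex_dist \<Phi> q x p \<le> enat r \<longleftrightarrow> blinfun_apply a0 (x - p) \<le> real r"
proof -
  have rs: "root_system \<Phi>" using assms(1) unfolding irreducible_root_system_def by blast
  have facet: "facet \<Phi> q = facet \<Phi> p"
    using facet_change_base special_vertex_integral[OF rs assms(3)] by blast
  have vertex: "vertex \<Phi> q = vertex \<Phi> p"
    unfolding vertex_def[abs_def] facets_def facet ..
  have adjacent: "adjacent \<Phi> q = adjacent \<Phi> p"
    unfolding adjacent_def[abs_def] facets_def facet vertex ..
  have a0: "a0 \<in> \<Phi>" using assms(6) unfolding highest_root_def by blast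
  show ?thesis
    unfolding vertex_dist_le_iff adjacent
  proof
    assume "\<exists>m\<le>r. (adjacent \<Phi> p ^^ m) x p"
    then show "blinfun_apply a0 (x - p) \<le> real r"
      using relpow_adjacent_diff_le[OF _ a0] by (meson of_nat_le_iff order_trans)
  next
    assume le: "blinfun_apply a0 (x - p) \<le> real r"
    \<comment> \<open>Here the position of \<open>x\<close> in the closed chamber enters, turning
      the bound on \<open>a0\<close> into one on all roots.\<close>
    have "\<forall>a\<in>\<Phi>. blinfun_apply a (x - p) \<le> real r"
      using highest_root_ge[OF assms(5,6)] nonneg_on_closure_chamber[OF assms(5,8)] le
      by (meson order_trans)
    then show "\<exists>m\<le>r. (adjacent \<Phi> p ^^ m) x p"
      using relpow_adjacent_if_descending[OF descending_classical_type[OF finite_root_system[OF rs] assms(2)]]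
        rs root_system_uminus[OF rs] assms(7) vertex unfolding root_system_def by metis
  qed
qed

end
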